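(* Consider the adaptive algorithm AFEM-PGMRES described in the context with quasi-error $\mathsf H_\ell^k=\eta_\ell(u_\ell^k)+\|\mathbf s_\ell^k\|_{\mathbf P_\ell^{-1}}$. Suppose that the error estimator satisfies (A1), (A2), (A3), (A3$^+$) and that the employed preconditioners satisfy the norm equivalence (PRE). Define $$C_{\rm eq}:=\max\{1,\ (1+C_{\rm stab})\,C_{\rm ell}^{-1}C_{\rm pre},\ C_{\rm bnd}C_{\rm pre}+C_{\rm stab}\}>0.$$ Then $$C_{\rm eq}^{-1}\big(\eta_\ell(u_\ell^\star)+|||u_\ell^\star-u_\ell^k|||\big)\le\mathsf H_\ell^k\le C_{\rm eq}\big(\eta_\ell(u_\ell^\star)+|||u_\ell^\star-u_\ell^k|||\big)\qquad\text{for all }(\ell,k)\in\mathcal Q.$$ Moreover, with $C_{\rm rel}':=C_{\rm eq}\max\{C_{\rm rel},1\}>0$, $$|||u^\star-u_\ell^k|||\le C_{\rm rel}'\,\mathsf H_\ell^k\qquad\text{for all }(\ell,k)\in\mathcal Q.$$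
   Context: **Model problem.** $\Omega\subset\mathbb R^d$ ($d\ge1$) is a polyhedral Lipschitz domain, $\mathcal X:=H^1_0(\Omega)$, $f\in L^2(\Omega)$, $\boldsymbol f\in[L^2(\Omega)]^d$, $\boldsymbol b\in[L^\infty(\Omega)]^d$ with $\operatorname{div}\boldsymbol b\in L^\infty(\Omega)$, $c\in L^\infty(\Omega)$, $-\operatorname{div}\boldsymbol b+2c\ge0$ a.e., and $\boldsymbol K\in[L^\infty(\Omega)]^{d\times d}$ symmetric with smallest eigenvalue uniformly bounded from below by a positive constant. Set $a(v,w):=\langle\boldsymbol K\nabla v,\nabla w\rangle_{L^2(\Omega)}$, $b(v,w):=a(v,w)+\langle\boldsymbol b\cdot\nabla v,w\rangle_{L^2(\Omega)}+\langle cv,w\rangle_{L^2(\Omega)}$, $F(v):=\langle f,v\rangle_{L^2(\Omega)}+\langle\boldsymbol f,\nabla v\rangle_{L^2(\Omega)}$, $|||v|||:=a(v,v)^{1/2}$. There are constants $0<C_{\rm ell}\le C_{\rm bnd}$ with $|b(v,w)|\le C_{\rm bnd}|||v|||\,|||w|||$ and $b(v,v)\ge C_{\rm ell}|||v|||^2$ on $\mathcal X$. The exact solution $u^\star\in\mathcal X$ satisfies $b(u^\star,v)=F(v)$ for all $v\in\mathcal X$. **Discretization.** $\mathcal T_0$ is a conforming simplicial triangulation of $\Omega$ (admissible for newest vertex bisection, NVB), and $\boldsymbol f|_T\in[H^1(T)]^d$, $\boldsymbol K|_T\in[W^{1,\infty}(T)]^{d\times d}$ for all $T\in\mathcal T_0$.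 $\mathbb T(\mathcal T_H)$ is the set of triangulations obtained from $\mathcal T_H$ by finitely many NVB steps; $\mathtt{refine}(\mathcal T_H,\mathcal M_H)$ is the coarsest NVB refinement of $\mathcal T_H$ in which all elements of $\mathcal M_H\subseteq\mathcal T_H$ are refined. For fixed $p\in\mathbb N$, $\mathcal X_H\subset H^1_0(\Omega)$ is the space of globally continuous $\mathcal T_H$-piecewise polynomials of degree $\le p$ vanishing on $\partial\Omega$. $u_H^\star\in\mathcal X_H$ is the Galerkin solution: $b(u_H^\star,v_H)=F(v_H)$ for all $v_H\in\mathcal X_H$. Index $\ell$ replaces $H$ for the mesh $\mathcal T_\ell$. **Estimator.** For $T\in\mathcal T_H$, $v_H\in\mathcal X_H$: $\eta_H(T,v_H)^2:=|T|^{2/d}\|\operatorname{div}(\boldsymbol K\nabla v_H-\boldsymbol f)-\boldsymbol b\cdot\nabla v_H-cv_H+f\|_{L^2(T)}^2+|T|^{1/d}\|[\![(\boldsymbol K\nabla v_H-\boldsymbol f)\cdot n]\!]\|^2_{L^2(\partial T\cap\Omega)}$, where $[\![\cdot]\!]$ is the jump over facets; $\eta_H(\mathcal U_H,v_H):=(\sum_{T\in\mathcal U_H}\eta_H(T,v_H)^2)^{1/2}$ for $\mathcal U_H\subseteq\mathcal T_H$, and $\eta_H(v_H):=\eta_H(\mathcal T_H,v_H)$. The axioms are, with constants $C_{\rm stab},C_{\rm rel},C_{\rm drel}>0$, $0<q_{\rm red}<1$, for all $\mathcal T_H\in\mathbb T(\mathcal T_0)$, $\mathcal T_h\in\mathbb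 T(\mathcal T_H)$, $v_H\in\mathcal X_H$, $v_h\in\mathcal X_h$: (A1) $|\eta_h(\mathcal T_h\cap\mathcal T_H,v_h)-\eta_H(\mathcal T_h\cap\mathcal T_H,v_H)|\le C_{\rm stab}|||v_h-v_H|||$; (A2) $\eta_h(\mathcal T_h\setminus\mathcal T_H,v_H)\le q_{\rm red}\,\eta_H(\mathcal T_H\setminus\mathcal T_h,v_H)$; (A3) $|||u^\star-u_H^\star|||\le C_{\rm rel}\,\eta_H(u_H^\star)$; (A3$^+$) $|||u_h^\star-u_H^\star|||\le C_{\rm drel}\,\eta_H(\mathcal T_H\setminus\mathcal T_h,u_H^\star)$. **Preconditioner.** Let $\varphi_{\ell,1},\dots,\varphi_{\ell,N_\ell}$ be a basis of $\mathcal X_\ell$, $(\mathbf B_\ell)_{jk}:=b(\varphi_{\ell,k},\varphi_{\ell,j})$, $(\mathbf d_\ell)_j:=F(\varphi_{\ell,j})$. $\mathbf P_\ell\in\mathbb R^{N_\ell\times N_\ell}$ is symmetric positive definite, $(\mathbf x,\mathbf y)_{\mathbf P_\ell^{-1}}:=(\mathbf P_\ell^{-1}\mathbf x,\mathbf y)_2$ with induced norm $\|\cdot\|_{\mathbf P_\ell^{-1}}$. (PRE): there is $C_{\rm pre}\ge1$, independent of $\ell$, the mesh size and $p$, with $C_{\rm pre}^{-1}|||v_\ell|||\le\|\mathbf x_\ell\|_{\mathbf P_\ell^{-1}}\le C_{\rm pre}|||v_\ell|||$ for all $v_\ell=\sum_j(\mathbf x_\ell)_j\varphi_{\ell,j}\in\mathcal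 X_\ell$. **PGMRES (preconditioned GMRES with restart length $k_{\max}\in\mathbb N$).** Given $\mathbf x_\ell^0$, iterates are defined for $k\ge1$ as follows: with $K:=((k-1)\bmod k_{\max})+1$ and $m:=k-K$ (the index of the last restart), $\mathbf x_\ell^k$ is the unique minimizer of $\|\mathbf P_\ell(\mathbf d_\ell-\mathbf B_\ell\mathbf x)\|_{\mathbf P_\ell^{-1}}$ over $\mathbf x\in\mathbf x_\ell^m+\operatorname{span}\{(\mathbf P_\ell\mathbf B_\ell)^i\mathbf s_\ell^m:0\le i<K\}$, where $\mathbf s_\ell^k:=\mathbf P_\ell(\mathbf d_\ell-\mathbf B_\ell\mathbf x_\ell^k)$ is the preconditioned residual. Write $u_\ell^k:=\sum_j(\mathbf x_\ell^k)_j\varphi_{\ell,j}$. **Algorithm AFEM-PGMRES.** Input: $\mathcal T_0$, $0<\theta\le1$, $C_{\rm mark}\ge1$, $u_0^0\in\mathcal X_0$, $C_{\rm alg},\lambda_{\rm alg}>0$, $k_{\max}\in\mathbb N$, tolerance $\tau$; set $\mathsf S:=0$. Write $\mathsf H_\ell^k:=\eta_\ell(u_\ell^k)+\|\mathbf s_\ell^k\|_{\mathbf P_\ell^{-1}}$. For $\ell=0,1,2,\dots$: (i) Starting from $u_\ell^0$, perform PGMRES steps $k=1,2,\dots$ until, for the first time, $\|\mathbf s_\ell^k\|_{\mathbf P_\ell^{-1}}\le\lambda_{\rm alg}\,\eta_\ell(u_\ell^k)$; set $\underline k[\ell]:=k$ (if this never happens, $\underline k[\ell]:=\infty$ and the algorithm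 iterates forever on level $\ell$). Write $\underline k=\underline k[\ell]$ in $u_\ell^{\underline k}$, $\mathsf H_\ell^{\underline k}$. (ii) If $\mathsf H_\ell^{\underline k}\le\tau$, stop. Otherwise: (a) if $\ell\ge1$ and $\mathsf S>C_{\rm alg}(\mathsf H_\ell^{\underline k})^{-1}$, replace $C_{\rm alg}$ by $2C_{\rm alg}$ and $\lambda_{\rm alg}$ by $\lambda_{\rm alg}/2$; (b) replace $\mathsf S$ by $\mathsf S+(\mathsf H_\ell^{\underline k})^{-1}$. (Convention $1/0=\infty$.) (iii) Choose $\mathcal M_\ell\subseteq\mathcal T_\ell$ with $\theta\eta_\ell(u_\ell^{\underline k})^2\le\eta_\ell(\mathcal M_\ell,u_\ell^{\underline k})^2$ and $\#\mathcal M_\ell\le C_{\rm mark}\min\{\#\mathcal U:\mathcal U\subseteq\mathcal T_\ell,\ \theta\eta_\ell(u_\ell^{\underline k})^2\le\eta_\ell(\mathcal U,u_\ell^{\underline k})^2\}$. (iv) $\mathcal T_{\ell+1}:=\mathtt{refine}(\mathcal T_\ell,\mathcal M_\ell)$, $u_{\ell+1}^0:=u_\ell^{\underline k}$. **Index set.** $\mathcal Q$ is the set of all $(\ell,k)\in\mathbb N_0^2$ such that $u_\ell^k$ appears in the algorithm. *)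

theory Defs
  imports
    "HOL-Analysis.Analysis"
    "HOL-Library.Extended_Nat"
    "HOL-Library.Extended_Real"
    "Jordan_Normal_Form.Gauss_Jordan_Elimination"
    "Jordan_Normal_Form.VS_Connect"
begin

text \<open>
  Points of the domain live in \<open>real ^ 'd\<close>, so the space dimension is \<open>CARD('d)\<close>. Linear systems,
  whose size varies with the mesh, use the matrices and vectors of \<open>Jordan_Normal_Form\<close>. The symbols
  shared by both libraries are reserved for \<open>real ^ 'd\<close>.
\<close>

no_notation Matrix.vec_index (infixl \<open>$\<close> 100)
no_notation Matrix.scalar_prod (infix \<open>\<bullet>\<close> 70)


section \<open>Weak derivatives, Lebesgue and Sobolev spaces\<close>

definition partial :: "'d::finite \<Rightarrow> (real ^ 'd \<Rightarrow> real) \<Rightarrow> real ^ 'd \<Rightarrow> real" where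
  "partial i f x = frechet_derivative f (at x) (axis i 1)"

primrec iter_partial :: "'d::finite list \<Rightarrow> (real ^ 'd \<Rightarrow> real) \<Rightarrow> real ^ 'd \<Rightarrow> real" where
  "iter_partial [] f = f"
| "iter_partial (i # is) f = partial i (iter_partial is f)"

definition smooth :: "(real ^ 'd::finite \<Rightarrow> real) \<Rightarrow> bool" where
  "smooth f \<longleftrightarrow> (\<forall>is x. iter_partial is f differentiable (at x))"

definition grad :: "(real ^ 'd::finite \<Rightarrow> real) \<Rightarrow> real ^ 'd \<Rightarrow> real ^ 'd" where
  "grad f x = (\<chi> i. partial i f x)"

definition test_fun :: "(real ^ 'd::finite) set \<Rightarrow> (real ^ 'd \<Rightarrow> real) \<Rightarrow> bool" where
  "test_fun U f \<longleftrightarrow> smooth f \<and> (\<exists>C. compact C \<and> C \<subseteq> U \<and> (\<forall>x. x \<notin> C \<longrightarrow> f x = 0))"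

definition loc_integrable ::
  "(real ^ 'd::finite) set \<Rightarrow> (real ^ 'd \<Rightarrow> 'b::euclidean_space) \<Rightarrow> bool" where
  "loc_integrable U f \<longleftrightarrow> (\<forall>C. compact C \<and> C \<subseteq> U \<longrightarrow> integrable (lebesgue_on C) f)"

definition L2 :: "(real ^ 'd::finite) set \<Rightarrow> (real ^ 'd \<Rightarrow> 'b::euclidean_space) \<Rightarrow> bool" where
  "L2 U f \<longleftrightarrow> f \<in> borel_measurable (lebesgue_on U) \<and>
     integrable (lebesgue_on U) (\<lambda>x. (norm (f x))\<^sup>2)"

definition L2norm :: "(real ^ 'd::finite) set \<Rightarrow> (real ^ 'd \<Rightarrow> 'b::euclidean_space) \<Rightarrow> real" where
  "L2norm U f = sqrt (\<integral>x. (norm (f x))\<^sup>2 \<partial>lebesgue_on U)"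

definition Linf :: "(real ^ 'd::finite) set \<Rightarrow> (real ^ 'd \<Rightarrow> 'b::euclidean_space) \<Rightarrow> bool" where
  "Linf U f \<longleftrightarrow> f \<in> borel_measurable (lebesgue_on U) \<and>
     (\<exists>C. AE x in lebesgue_on U. norm (f x) \<le> C)"

definition weak_grad ::
  "(real ^ 'd::finite) set \<Rightarrow> (real ^ 'd \<Rightarrow> real) \<Rightarrow> (real ^ 'd \<Rightarrow> real ^ 'd) \<Rightarrow> bool" where
  "weak_grad U v g \<longleftrightarrow> loc_integrable U v \<and> loc_integrable U g \<and>
     (\<forall>\<phi> i. test_fun U \<phi> \<longrightarrow>
        (\<integral>x. v x * partial i \<phi> x \<partial>lebesgue_on U) = - (\<integral>x. g x $ i * \<phi> x \<partial>lebesgue_on U))"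

definition weak_div ::
  "(real ^ 'd::finite) set \<Rightarrow> (real ^ 'd \<Rightarrow> real ^ 'd) \<Rightarrow> (real ^ 'd \<Rightarrow> real) \<Rightarrow> bool" where
  "weak_div U F g \<longleftrightarrow> loc_integrable U F \<and> loc_integrable U g \<and>
     (\<forall>\<phi>. test_fun U \<phi> \<longrightarrow>
        (\<integral>x. F x \<bullet> grad \<phi> x \<partial>lebesgue_on U) = - (\<integral>x. g x * \<phi> x \<partial>lebesgue_on U))"

text \<open>
  Weak gradient and divergence are determined only up to null sets. The choice operator picks a
  representative; every later use is invariant under changes on null sets.
\<close>

definition wgrad :: "(real ^ 'd::finite) set \<Rightarrow> (real ^ 'd \<Rightarrow> real) \<Rightarrow> real ^ 'd \<Rightarrow> real ^ 'd" where
  "wgrad U v = (SOME g. weak_grad U v g)"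

definition wdiv :: "(real ^ 'd::finite) set \<Rightarrow> (real ^ 'd \<Rightarrow> real ^ 'd) \<Rightarrow> real ^ 'd \<Rightarrow> real" where
  "wdiv U F = (SOME g. weak_div U F g)"

definition H1 :: "(real ^ 'd::finite) set \<Rightarrow> (real ^ 'd \<Rightarrow> real) \<Rightarrow> bool" where
  "H1 U v \<longleftrightarrow> L2 U v \<and> (\<exists>g. weak_grad U v g \<and> L2 U g)"

definition W1inf :: "(real ^ 'd::finite) set \<Rightarrow> (real ^ 'd \<Rightarrow> real) \<Rightarrow> bool" where
  "W1inf U v \<longleftrightarrow> Linf U v \<and> (\<exists>g. weak_grad U v g \<and> Linf U g)"

definition H1_conv ::
  "(real ^ 'd::finite) set \<Rightarrow> (nat \<Rightarrow> real ^ 'd \<Rightarrow> real) \<Rightarrow> (real ^ 'd \<Rightarrow> real) \<Rightarrow> bool" where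
  "H1_conv U \<phi> v \<longleftrightarrow>
     (\<lambda>n. L2norm U (\<lambda>x. \<phi> n x - v x)) \<longlonglongrightarrow> 0 \<and>
     (\<lambda>n. L2norm U (\<lambda>x. grad (\<phi> n) x - wgrad U v x)) \<longlonglongrightarrow> 0"

definition H10 :: "(real ^ 'd::finite) set \<Rightarrow> (real ^ 'd \<Rightarrow> real) set" where
  "H10 U = {v. H1 U v \<and> (\<exists>\<phi>. (\<forall>n. test_fun U (\<phi> n)) \<and> H1_conv U \<phi> v)}"


section \<open>Polyhedral Lipschitz domains\<close>

text \<open>
  \<open>x - (x \<bullet> e) *\<^sub>R e\<close> is the orthogonal projection to the hyperplane normal to the unit
  vector \<open>e\<close>. Near each boundary point the domain is the strict epigraph, in direction \<open>e\<close>, of a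
  Lipschitz function over that hyperplane.
\<close>

definition lipschitz_domain :: "(real ^ 'd::finite) set \<Rightarrow> bool" where
  "lipschitz_domain \<Omega> \<longleftrightarrow> open \<Omega> \<and> connected \<Omega> \<and> bounded \<Omega> \<and> \<Omega> \<noteq> {} \<and>
     (\<forall>x\<in>frontier \<Omega>. \<exists>e r h L (\<gamma> :: real ^ 'd \<Rightarrow> real).
        norm e = 1 \<and> 0 < r \<and> 0 < h \<and> L-lipschitz_on UNIV \<gamma> \<and>
        (\<forall>y. norm (y - (y \<bullet> e) *\<^sub>R e) < r \<and> \<bar>y \<bullet> e\<bar> < h \<longrightarrow>
             (x + y \<in> \<Omega> \<longleftrightarrow> \<gamma> (y - (y \<bullet> e) *\<^sub>R e) < y \<bullet> e)))"

definition polyhedral_lipschitz_domain :: "(real ^ 'd::finite) set \<Rightarrow> bool" where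
  "polyhedral_lipschitz_domain \<Omega> \<longleftrightarrow> lipschitz_domain \<Omega> \<and>
     (\<exists>\<P>. finite \<P> \<and> (\<forall>P\<in>\<P>. polytope P) \<and> closure \<Omega> = \<Union>\<P>)"


section \<open>Model problem\<close>

record 'd pde =
  dom :: "(real ^ 'd::finite) set"
  diffusion :: "real ^ 'd \<Rightarrow> real ^ 'd ^ 'd"
  convection :: "real ^ 'd \<Rightarrow> real ^ 'd"
  reaction :: "real ^ 'd \<Rightarrow> real"
  load :: "real ^ 'd \<Rightarrow> real"
  vload :: "real ^ 'd \<Rightarrow> real ^ 'd"

definition eigval :: "real ^ 'd ^ 'd::finite \<Rightarrow> real \<Rightarrow> bool" where
  "eigval A \<mu> \<longleftrightarrow> (\<exists>v. v \<noteq> 0 \<and> A *v v = \<mu> *\<^sub>R v)"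

definition model_problem :: "'d::finite pde \<Rightarrow> bool" where
  "model_problem D \<longleftrightarrow>
     polyhedral_lipschitz_domain (dom D) \<and>
     L2 (dom D) (load D) \<and> L2 (dom D) (vload D) \<and>
     Linf (dom D) (convection D) \<and> Linf (dom D) (reaction D) \<and>
     (\<exists>db. weak_div (dom D) (convection D) db \<and> Linf (dom D) db \<and>
        (AE x in lebesgue_on (dom D). 0 \<le> - db x + 2 * reaction D x)) \<and>
     Linf (dom D) (diffusion D) \<and>
     (AE x in lebesgue_on (dom D). transpose (diffusion D x) = diffusion D x) \<and>
     (\<exists>\<kappa>>0. AE x in lebesgue_on (dom D). \<forall>\<mu>. eigval (diffusion D x) \<mu> \<longrightarrow> \<kappa> \<le> \<mu>)"

definition a_form :: "'d::finite pde \<Rightarrow> (real ^ 'd \<Rightarrow> real) \<Rightarrow> (real ^ 'd \<Rightarrow> real) \<Rightarrow> real" where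
  "a_form D v w =
     (\<integral>x. (diffusion D x *v wgrad (dom D) v x) \<bullet> wgrad (dom D) w x \<partial>lebesgue_on (dom D))"

definition b_form :: "'d::finite pde \<Rightarrow> (real ^ 'd \<Rightarrow> real) \<Rightarrow> (real ^ 'd \<Rightarrow> real) \<Rightarrow> real" where
  "b_form D v w = a_form D v w
     + (\<integral>x. (convection D x \<bullet> wgrad (dom D) v x) * w x \<partial>lebesgue_on (dom D))
     + (\<integral>x. reaction D x * v x * w x \<partial>lebesgue_on (dom D))"

definition F_form :: "'d::finite pde \<Rightarrow> (real ^ 'd \<Rightarrow> real) \<Rightarrow> real" where
  "F_form D v = (\<integral>x. load D x * v x \<partial>lebesgue_on (dom D))
     + (\<integral>x. vload D x \<bullet> wgrad (dom D) v x \<partial>lebesgue_on (dom D))"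

definition enorm :: "'d::finite pde \<Rightarrow> (real ^ 'd \<Rightarrow> real) \<Rightarrow> real" where
  "enorm D v = sqrt (a_form D v v)"

definition bounded_elliptic :: "'d::finite pde \<Rightarrow> real \<Rightarrow> real \<Rightarrow> bool" where
  "bounded_elliptic D Cell Cbnd \<longleftrightarrow> 0 < Cell \<and> Cell \<le> Cbnd \<and>
     (\<forall>v\<in>H10 (dom D). \<forall>w\<in>H10 (dom D). \<bar>b_form D v w\<bar> \<le> Cbnd * enorm D v * enorm D w) \<and>
     (\<forall>v\<in>H10 (dom D). Cell * (enorm D v)\<^sup>2 \<le> b_form D v v)"

definition exact_solution :: "'d::finite pde \<Rightarrow> (real ^ 'd \<Rightarrow> real) \<Rightarrow> bool" where
  "exact_solution D u \<longleftrightarrow> u \<in> H10 (dom D) \<and> (\<forall>v\<in>H10 (dom D). b_form D u v = F_form D v)"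


section \<open>Simplicial meshes and newest vertex bisection\<close>

text \<open>
  A simplex carries the vertex order \<open>[x\<^sub>0, \<dots>, x\<^sub>d]\<close> and the type in \<open>{0, \<dots>, d - 1}\<close> that
  steer newest vertex bisection in the formulation of Maubach, Traxler and Stevenson; the refinement
  edge joins the first and the last vertex. All meshes below descend from one initial mesh in which
  every simplex occurs with one tag only, so set operations on tagged meshes agree with those on the
  underlying simplices.
\<close>

type_synonym 'd tsimplex = "(real ^ 'd) list \<times> nat"
type_synonym 'd mesh = "'d tsimplex set"

definition verts :: "'d::finite tsimplex \<Rightarrow> (real ^ 'd) set" where
  "verts T = set (fst T)"

definition elem :: "'d::finite tsimplex \<Rightarrow> (real ^ 'd) set" where
  "elem T = convex hull (verts T)"

definition valid_simplex :: "'d::finite tsimplex \<Rightarrow> bool" where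
  "valid_simplex T \<longleftrightarrow> length (fst T) = CARD('d) + 1 \<and> distinct (fst T) \<and>
     \<not> affine_dependent (verts T) \<and> snd T < CARD('d)"

definition conforming :: "'d::finite mesh \<Rightarrow> bool" where
  "conforming M \<longleftrightarrow> finite M \<and> (\<forall>T\<in>M. valid_simplex T) \<and>
     (\<forall>T\<in>M. \<forall>T'\<in>M. T \<noteq> T' \<longrightarrow>
        verts T \<noteq> verts T' \<and> elem T \<inter> elem T' = convex hull (verts T \<inter> verts T'))"

definition share_facet :: "'d::finite tsimplex \<Rightarrow> 'd tsimplex \<Rightarrow> bool" where
  "share_facet T T' \<longleftrightarrow> card (verts T \<inter> verts T') = CARD('d)"

definition children :: "'d::finite tsimplex \<Rightarrow> 'd tsimplex set" where
  "children T = (case T of (xs, \<gamma>) \<Rightarrow>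
     let m = midpoint (hd xs) (last xs); ys = butlast (tl xs); \<gamma>' = (\<gamma> + 1) mod CARD('d) in
     {(hd xs # m # ys, \<gamma>'),
      (last xs # m # take \<gamma> ys @ rev (drop \<gamma> ys), \<gamma>')})"

definition bisection :: "('d::finite mesh \<times> 'd mesh) set" where
  "bisection = {(M, (M - {T}) \<union> children T) | M T. T \<in> M}"

definition refinements :: "'d::finite mesh \<Rightarrow> 'd mesh set" where
  "refinements M = {M'. (M, M') \<in> bisection\<^sup>* \<and> conforming M'}"

text \<open>\<open>is_refine M U M'\<close> states that \<open>M'\<close> is the coarsest refinement of \<open>M\<close> with all of \<open>U\<close> refined.\<close>

definition is_refine :: "'d::finite mesh \<Rightarrow> 'd mesh \<Rightarrow> 'd mesh \<Rightarrow> bool" where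
  "is_refine M U M' \<longleftrightarrow> M' \<in> refinements M \<and> U \<inter> M' = {} \<and>
     (\<forall>M''\<in>refinements M. U \<inter> M'' = {} \<longrightarrow> M'' \<in> refinements M')"

text \<open>
  Stevenson's matching condition (The completion of locally refined simplicial partitions created by
  bisection, Math. Comp. 77, 2008). The list \<open>flip T\<close> describes the same bisection as \<open>T\<close>, with the
  two children exchanged. For \<open>d \<le> 2\<close> newest vertex bisection needs no condition on the tags of the
  initial mesh.
\<close>

definition flip :: "'d::finite tsimplex \<Rightarrow> (real ^ 'd) list" where
  "flip T = (case T of (xs, \<gamma>) \<Rightarrow>
     let ys = butlast (tl xs) in last xs # take \<gamma> ys @ rev (drop \<gamma> ys) @ [hd xs])"

definition reflected_neighbours :: "'d::finite tsimplex \<Rightarrow> 'd tsimplex \<Rightarrow> bool" where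
  "reflected_neighbours T T' \<longleftrightarrow> share_facet T T' \<and> snd T = snd T' \<and>
     (\<exists>xs\<in>{fst T, flip T}. card {i. i \<le> CARD('d) \<and> xs ! i \<noteq> fst T' ! i} = 1)"

definition matching :: "'d::finite mesh \<Rightarrow> bool" where
  "matching M \<longleftrightarrow> (\<forall>T\<in>M. \<forall>T'\<in>M. snd T = snd T' \<and> (share_facet T T' \<longrightarrow>
     (if {hd (fst T), last (fst T)} \<subseteq> verts T' \<or> {hd (fst T'), last (fst T')} \<subseteq> verts T
      then reflected_neighbours T T'
      else \<forall>C\<in>children T. \<forall>C'\<in>children T'. share_facet C C' \<longrightarrow> reflected_neighbours C C')))"

definition admissible_mesh :: "(real ^ 'd::finite) set \<Rightarrow> 'd mesh \<Rightarrow> bool" where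
  "admissible_mesh \<Omega> M \<longleftrightarrow> conforming M \<and> \<Union> (elem ` M) = closure \<Omega> \<and>
     (3 \<le> CARD('d) \<longrightarrow> matching M)"

definition initial_mesh :: "'d::finite pde \<Rightarrow> 'd mesh \<Rightarrow> bool" where
  "initial_mesh D T0 \<longleftrightarrow> admissible_mesh (dom D) T0 \<and>
     (\<forall>T\<in>T0. \<forall>i. H1 (interior (elem T)) (\<lambda>x. vload D x $ i)) \<and>
     (\<forall>T\<in>T0. \<forall>i j. W1inf (interior (elem T)) (\<lambda>x. diffusion D x $ i $ j))"


section \<open>Discrete spaces\<close>

definition is_poly :: "nat \<Rightarrow> (real ^ 'd::finite \<Rightarrow> real) \<Rightarrow> bool" where
  "is_poly p q \<longleftrightarrow> (\<exists>c :: ('d \<Rightarrow> nat) \<Rightarrow> real.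
     \<forall>x. q x = (\<Sum>\<alpha> | sum \<alpha> UNIV \<le> p. c \<alpha> * (\<Prod>i\<in>UNIV. (x $ i) ^ \<alpha> i)))"

text \<open>
  Discrete functions are normalised to vanish outside the domain (and hence on its boundary), so
  that they form a finite-dimensional space of functions on the whole of \<open>real ^ 'd\<close>.
\<close>

definition fe_space :: "'d::finite pde \<Rightarrow> nat \<Rightarrow> 'd mesh \<Rightarrow> (real ^ 'd \<Rightarrow> real) set" where
  "fe_space D p M = {v \<in> H10 (dom D). continuous_on (closure (dom D)) v \<and>
     (\<forall>x. x \<notin> dom D \<longrightarrow> v x = 0) \<and>
     (\<forall>T\<in>M. \<exists>q. is_poly p q \<and> (\<forall>x\<in>elem T. v x = q x))}"

definition galerkin_solution ::
  "'d::finite pde \<Rightarrow> nat \<Rightarrow> 'd mesh \<Rightarrow> (real ^ 'd \<Rightarrow> real) \<Rightarrow> bool" where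
  "galerkin_solution D p M u \<longleftrightarrow> u \<in> fe_space D p M \<and>
     (\<forall>v\<in>fe_space D p M. b_form D u v = F_form D v)"


section \<open>Residual error estimator\<close>

definition facet_normal :: "(real ^ 'd::finite) set \<Rightarrow> real ^ 'd" where
  "facet_normal S = (SOME n. norm n = 1 \<and> (\<forall>x\<in>S. \<forall>y\<in>S. n \<bullet> (x - y) = 0))"

text \<open>
  Surface measure on the facet with vertex set \<open>S\<close>: by Fubini, it is the image of Lebesgue measure
  on the prism of height \<open>1\<close> over the facet under projection along the normal. For \<open>d = 1\<close> it is
  the point mass.
\<close>

definition facet_measure :: "(real ^ 'd::finite) set \<Rightarrow> (real ^ 'd) measure" where
  "facet_measure S = (let n = facet_normal S; z = (SOME z. z \<in> S) in
     distr (restrict_space lborel {x + t *\<^sub>R n | x t. x \<in> convex hull S \<and> 0 \<le> t \<and> t \<le> 1})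
       borel (\<lambda>y. y - ((y - z) \<bullet> n) *\<^sub>R n))"

text \<open>\<open>\<mu>\<close> is the surface measure of a facet of \<open>U\<close>; traces are limits of restrictions of smooth functions.\<close>

definition is_trace :: "(real ^ 'd::finite) set \<Rightarrow> (real ^ 'd) measure \<Rightarrow>
    (real ^ 'd \<Rightarrow> real) \<Rightarrow> (real ^ 'd \<Rightarrow> real) \<Rightarrow> bool" where
  "is_trace U \<mu> w g \<longleftrightarrow> H1 U w \<and> g \<in> borel_measurable borel \<and> integrable \<mu> (\<lambda>x. (g x)\<^sup>2) \<and>
     (\<exists>\<phi>. (\<forall>n. smooth (\<phi> n)) \<and> H1_conv U \<phi> w \<and>
        (\<lambda>n. \<integral>x. (\<phi> n x - g x)\<^sup>2 \<partial>\<mu>) \<longlonglongrightarrow> 0)"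

definition trace_vec :: "(real ^ 'd::finite) set \<Rightarrow> (real ^ 'd) measure \<Rightarrow>
    (real ^ 'd \<Rightarrow> real ^ 'd) \<Rightarrow> real ^ 'd \<Rightarrow> real ^ 'd" where
  "trace_vec U \<mu> q x = (\<chi> i. (SOME g. is_trace U \<mu> (\<lambda>y. q y $ i) g) x)"

definition flux :: "'d::finite pde \<Rightarrow> (real ^ 'd \<Rightarrow> real) \<Rightarrow> real ^ 'd \<Rightarrow> real ^ 'd" where
  "flux D v x = diffusion D x *v wgrad (dom D) v x - vload D x"

text \<open>The orientation of the normal, hence the sign of the jump, is irrelevant after squaring.\<close>

definition jump_sq :: "'d::finite pde \<Rightarrow> (real ^ 'd \<Rightarrow> real) \<Rightarrow> 'd tsimplex \<Rightarrow> 'd tsimplex \<Rightarrow> real" where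
  "jump_sq D v T T' = (let S = verts T \<inter> verts T'; \<mu> = facet_measure S in
     \<integral>x. ((trace_vec (interior (elem T)) \<mu> (flux D v) x
           - trace_vec (interior (elem T')) \<mu> (flux D v) x) \<bullet> facet_normal S)\<^sup>2 \<partial>\<mu>)"

text \<open>
  In a conforming triangulation the facets of \<open>T\<close> inside the domain are those shared with another
  element, so the integral over \<open>\<partial>T \<inter> \<Omega>\<close> is a sum over the facet neighbours of \<open>T\<close>.
\<close>

definition eta_elem_sq :: "'d::finite pde \<Rightarrow> 'd mesh \<Rightarrow> 'd tsimplex \<Rightarrow> (real ^ 'd \<Rightarrow> real) \<Rightarrow> real" where
  "eta_elem_sq D M T v =
     measure lebesgue (elem T) powr (2 / real CARD('d)) *
       (L2norm (interior (elem T)) (\<lambda>x. wdiv (interior (elem T)) (flux D v) x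
          - convection D x \<bullet> wgrad (dom D) v x - reaction D x * v x + load D x))\<^sup>2
     + measure lebesgue (elem T) powr (1 / real CARD('d)) *
       (\<Sum>T' | T' \<in> M \<and> T' \<noteq> T \<and> share_facet T T'. jump_sq D v T T')"

definition eta_on :: "'d::finite pde \<Rightarrow> 'd mesh \<Rightarrow> 'd mesh \<Rightarrow> (real ^ 'd \<Rightarrow> real) \<Rightarrow> real" where
  "eta_on D M U v = sqrt (\<Sum>T\<in>U. eta_elem_sq D M T v)"

abbreviation eta :: "'d::finite pde \<Rightarrow> 'd mesh \<Rightarrow> (real ^ 'd \<Rightarrow> real) \<Rightarrow> real" where
  "eta D M v \<equiv> eta_on D M M v"

definition axiom_stability :: "'d::finite pde \<Rightarrow> nat \<Rightarrow> 'd mesh \<Rightarrow> real \<Rightarrow> bool" where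
  "axiom_stability D p T0 Cstab \<longleftrightarrow>
     (\<forall>TH\<in>refinements T0. \<forall>Th\<in>refinements TH. \<forall>vH\<in>fe_space D p TH. \<forall>vh\<in>fe_space D p Th.
        \<bar>eta_on D Th (Th \<inter> TH) vh - eta_on D TH (Th \<inter> TH) vH\<bar>
          \<le> Cstab * enorm D (\<lambda>x. vh x - vH x))"

definition axiom_reduction :: "'d::finite pde \<Rightarrow> nat \<Rightarrow> 'd mesh \<Rightarrow> real \<Rightarrow> bool" where
  "axiom_reduction D p T0 qred \<longleftrightarrow>
     (\<forall>TH\<in>refinements T0. \<forall>Th\<in>refinements TH. \<forall>vH\<in>fe_space D p TH.
        eta_on D Th (Th - TH) vH \<le> qred * eta_on D TH (TH - Th) vH)"

text \<open>In the next two definitions, \<open>uG M\<close> is the Galerkin solution on the mesh \<open>M\<close>.\<close>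

definition axiom_reliability :: "'d::finite pde \<Rightarrow> 'd mesh \<Rightarrow> (real ^ 'd \<Rightarrow> real) \<Rightarrow>
    ('d mesh \<Rightarrow> real ^ 'd \<Rightarrow> real) \<Rightarrow> real \<Rightarrow> bool" where
  "axiom_reliability D T0 u uG Crel \<longleftrightarrow>
     (\<forall>TH\<in>refinements T0. enorm D (\<lambda>x. u x - uG TH x) \<le> Crel * eta D TH (uG TH))"

definition axiom_discrete_reliability :: "'d::finite pde \<Rightarrow> 'd mesh \<Rightarrow>
    ('d mesh \<Rightarrow> real ^ 'd \<Rightarrow> real) \<Rightarrow> real \<Rightarrow> bool" where
  "axiom_discrete_reliability D T0 uG Cdrel \<longleftrightarrow>
     (\<forall>TH\<in>refinements T0. \<forall>Th\<in>refinements TH.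
        enorm D (\<lambda>x. uG Th x - uG TH x) \<le> Cdrel * eta_on D TH (TH - Th) (uG TH))"


section \<open>Linear systems and preconditioned GMRES\<close>

definition comb :: "nat \<Rightarrow> (nat \<Rightarrow> real ^ 'd::finite \<Rightarrow> real) \<Rightarrow> real Matrix.vec \<Rightarrow> real ^ 'd \<Rightarrow> real" where
  "comb N \<phi> x = (\<lambda>z. \<Sum>j<N. vec_index x j * \<phi> j z)"

definition is_basis :: "nat \<Rightarrow> (nat \<Rightarrow> real ^ 'd::finite \<Rightarrow> real) \<Rightarrow> (real ^ 'd \<Rightarrow> real) set \<Rightarrow> bool" where
  "is_basis N \<phi> X \<longleftrightarrow> bij_betw (comb N \<phi>) (carrier_vec N) X"

definition stiffness :: "'d::finite pde \<Rightarrow> nat \<Rightarrow> (nat \<Rightarrow> real ^ 'd \<Rightarrow> real) \<Rightarrow> real Matrix.mat" where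
  "stiffness D N \<phi> = Matrix.mat N N (\<lambda>(j, k). b_form D (\<phi> k) (\<phi> j))"

definition load_vec :: "'d::finite pde \<Rightarrow> nat \<Rightarrow> (nat \<Rightarrow> real ^ 'd \<Rightarrow> real) \<Rightarrow> real Matrix.vec" where
  "load_vec D N \<phi> = Matrix.vec N (\<lambda>j. F_form D (\<phi> j))"

definition spd :: "nat \<Rightarrow> real Matrix.mat \<Rightarrow> bool" where
  "spd N P \<longleftrightarrow> P \<in> carrier_mat N N \<and> transpose_mat P = P \<and>
     (\<forall>x\<in>carrier_vec N. x \<noteq> 0\<^sub>v N \<longrightarrow> 0 < scalar_prod x (P *\<^sub>v x))"

definition pnorm :: "real Matrix.mat \<Rightarrow> real Matrix.vec \<Rightarrow> real" where
  "pnorm P x = sqrt (scalar_prod (the (mat_inverse P) *\<^sub>v x) x)"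

definition presid :: "real Matrix.mat \<Rightarrow> real Matrix.mat \<Rightarrow> real Matrix.vec \<Rightarrow> real Matrix.vec \<Rightarrow>
    real Matrix.vec" where
  "presid P B d x = P *\<^sub>v (d - B *\<^sub>v x)"

definition krylov :: "nat \<Rightarrow> real Matrix.mat \<Rightarrow> real Matrix.mat \<Rightarrow> real Matrix.vec \<Rightarrow> nat \<Rightarrow>
    real Matrix.vec set" where
  "krylov N P B s K = LinearCombinations.module.span class_ring (module_vec TYPE(real) N)
     {((P * B) ^\<^sub>m i) *\<^sub>v s | i. i < K}"

definition pgmres_step :: "nat \<Rightarrow> nat \<Rightarrow> real Matrix.mat \<Rightarrow> real Matrix.mat \<Rightarrow> real Matrix.vec \<Rightarrow>
    (nat \<Rightarrow> real Matrix.vec) \<Rightarrow> nat \<Rightarrow> bool" where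
  "pgmres_step kmax N P B d xs k \<longleftrightarrow>
     (let K = (k - 1) mod kmax + 1; m = k - K in
      is_arg_min (\<lambda>x. pnorm P (presid P B d x))
        (\<lambda>x. \<exists>y\<in>krylov N P B (presid P B d (xs m)) K. x = xs m + y) (xs k))"


section \<open>The adaptive algorithm\<close>

text \<open>
  The quantities of a run, indexed by the level \<open>l\<close> (and the PGMRES step \<open>k\<close>). The fields \<open>calg\<close>,
  \<open>lam\<close> and \<open>acc\<close> hold the values of the algorithm's variables at the beginning of level \<open>l\<close>; \<open>acc\<close>
  is extended real since \<open>1 / 0 = \<infinity>\<close> there. Only the entries of levels and steps that the
  algorithm reaches are constrained.
\<close>

record 'd run =
  mesh :: "nat \<Rightarrow> 'd::finite mesh"
  marked :: "nat \<Rightarrow> 'd mesh"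
  ndof :: "nat \<Rightarrow> nat"
  basis :: "nat \<Rightarrow> nat \<Rightarrow> real ^ 'd \<Rightarrow> real"
  precond :: "nat \<Rightarrow> real Matrix.mat"
  coeffs :: "nat \<Rightarrow> nat \<Rightarrow> real Matrix.vec"
  kbar :: "nat \<Rightarrow> enat"
  calg :: "nat \<Rightarrow> real"
  lam :: "nat \<Rightarrow> real"
  acc :: "nat \<Rightarrow> ereal"

definition iterate :: "'d::finite run \<Rightarrow> nat \<Rightarrow> nat \<Rightarrow> real ^ 'd \<Rightarrow> real" where
  "iterate R l k = comb (ndof R l) (basis R l) (coeffs R l k)"

definition resid_norm :: "'d::finite pde \<Rightarrow> 'd run \<Rightarrow> nat \<Rightarrow> nat \<Rightarrow> real" where
  "resid_norm D R l k = pnorm (precond R l)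
     (presid (precond R l) (stiffness D (ndof R l) (basis R l))
       (load_vec D (ndof R l) (basis R l)) (coeffs R l k))"

definition quasi_error :: "'d::finite pde \<Rightarrow> 'd run \<Rightarrow> nat \<Rightarrow> nat \<Rightarrow> real" where
  "quasi_error D R l k = eta D (mesh R l) (iterate R l k) + resid_norm D R l k"

inductive reached :: "'d::finite pde \<Rightarrow> real \<Rightarrow> 'd run \<Rightarrow> nat \<Rightarrow> bool" for D \<tau> R where
  "reached D \<tau> R 0"
| "reached D \<tau> R l \<Longrightarrow> kbar R l = enat k \<Longrightarrow> \<not> quasi_error D R l k \<le> \<tau> \<Longrightarrow> reached D \<tau> R (Suc l)"

definition index_set :: "'d::finite pde \<Rightarrow> real \<Rightarrow> 'd run \<Rightarrow> (nat \<times> nat) set" where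
  "index_set D \<tau> R = {(l, k). reached D \<tau> R l \<and> enat k \<le> kbar R l}"

definition solve_level :: "'d::finite pde \<Rightarrow> nat \<Rightarrow> nat \<Rightarrow> 'd run \<Rightarrow> nat \<Rightarrow> bool" where
  "solve_level D p kmax R l \<longleftrightarrow>
     is_basis (ndof R l) (basis R l) (fe_space D p (mesh R l)) \<and>
     spd (ndof R l) (precond R l) \<and>
     coeffs R l 0 \<in> carrier_vec (ndof R l) \<and>
     (\<forall>k\<ge>1. enat k \<le> kbar R l \<longrightarrow>
        pgmres_step kmax (ndof R l) (precond R l) (stiffness D (ndof R l) (basis R l))
          (load_vec D (ndof R l) (basis R l)) (coeffs R l) k) \<and>
     (let stop = (\<lambda>k. 1 \<le> k \<and> resid_norm D R l k \<le> lam R l * eta D (mesh R l) (iterate R l k))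
      in kbar R l = (if \<exists>k. stop k then enat (LEAST k. stop k) else \<infinity>))"

definition doerfler :: "'d::finite pde \<Rightarrow> real \<Rightarrow> 'd mesh \<Rightarrow> (real ^ 'd \<Rightarrow> real) \<Rightarrow> 'd mesh \<Rightarrow> bool" where
  "doerfler D \<theta> M v U \<longleftrightarrow> U \<subseteq> M \<and> \<theta> * (eta D M v)\<^sup>2 \<le> (eta_on D M U v)\<^sup>2"

definition next_level :: "'d::finite pde \<Rightarrow> real \<Rightarrow> real \<Rightarrow> 'd run \<Rightarrow> nat \<Rightarrow> nat \<Rightarrow> bool" where
  "next_level D \<theta> Cmark R l k \<longleftrightarrow>
     (let invH = inverse (ereal (quasi_error D R l k)) in
      (if 1 \<le> l \<and> ereal (calg R l) * invH < acc R l
       then calg R (Suc l) = 2 * calg R l \<and> lam R (Suc l) = lam R l / 2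
       else calg R (Suc l) = calg R l \<and> lam R (Suc l) = lam R l) \<and>
      acc R (Suc l) = acc R l + invH) \<and>
     doerfler D \<theta> (mesh R l) (iterate R l k) (marked R l) \<and>
     real (card (marked R l))
       \<le> Cmark * real (Min (card ` {U. doerfler D \<theta> (mesh R l) (iterate R l k) U})) \<and>
     is_refine (mesh R l) (marked R l) (mesh R (Suc l)) \<and>
     iterate R (Suc l) 0 = iterate R l k"

definition afem_pgmres :: "'d::finite pde \<Rightarrow> nat \<Rightarrow> 'd mesh \<Rightarrow> real \<Rightarrow> real \<Rightarrow> real \<Rightarrow> real \<Rightarrow> nat \<Rightarrow> real \<Rightarrow>
    'd run \<Rightarrow> bool" where
  "afem_pgmres D p T0 \<theta> Cmark Calg lamalg kmax \<tau> R \<longleftrightarrow>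
     0 < \<theta> \<and> \<theta> \<le> 1 \<and> 1 \<le> Cmark \<and> 0 < Calg \<and> 0 < lamalg \<and> 1 \<le> kmax \<and>
     mesh R 0 = T0 \<and> calg R 0 = Calg \<and> lam R 0 = lamalg \<and> acc R 0 = 0 \<and>
     (\<forall>l. reached D \<tau> R l \<longrightarrow> solve_level D p kmax R l) \<and>
     (\<forall>l k. reached D \<tau> R l \<and> kbar R l = enat k \<and> \<not> quasi_error D R l k \<le> \<tau> \<longrightarrow>
        next_level D \<theta> Cmark R l k)"

definition norm_equivalence :: "'d::finite pde \<Rightarrow> real \<Rightarrow> 'd run \<Rightarrow> real \<Rightarrow> bool" where
  "norm_equivalence D \<tau> R Cpre \<longleftrightarrow> 1 \<le> Cpre \<and>
     (\<forall>l. reached D \<tau> R l \<longrightarrow> (\<forall>x\<in>carrier_vec (ndof R l).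
        inverse Cpre * enorm D (comb (ndof R l) (basis R l) x) \<le> pnorm (precond R l) x \<and>
        pnorm (precond R l) x \<le> Cpre * enorm D (comb (ndof R l) (basis R l) x)))"

end

theory Submission
  imports Defs
begin

text \<open>
  Let \<open>e\<close> be the algebraic error \<open>u\<^sub>l\<^sup>* - u\<^sub>l\<^sup>k\<close> with coefficient vector \<open>y\<close>, and \<open>s\<close> the preconditioned residual.
  Galerkin orthogonality gives \<open>(P\<^sup>-\<^sup>1 s, z) = b(e, v)\<close> whenever \<open>z\<close> is the coefficient vector of \<open>v\<close>.
  Taking \<open>z = y\<close> with ellipticity and \<open>z = s\<close> with boundedness, the Cauchy-Schwarz inequality and
  the norm equivalence show that \<open>e\<close> and \<open>s\<close> have equivalent norms. Stability of the estimator on a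
  single mesh and reliability do the rest. That the assembled matrices represent the forms at all needs
  linearity of the weak gradient, hence its uniqueness, which is the fundamental lemma of the
  calculus of variations.
\<close>

section \<open>Smooth bump functions\<close>

text \<open>The obstacle is that \<open>wgrad\<close> is a choice: the representative picked for a
  linear combination agrees with the combination of the picked ones only almost everywhere, and even
  its square integrability has to be transferred from the weak gradient that \<open>H1\<close>
  provides. Uniqueness settles both. Its proof needs test functions whose iterated partial
  derivatives all exist everywhere, so explicit ones are built from
  \<open>exp (- inverse t)\<close>; they approximate indicators of boxes, and Lebesgue
  differentiation recovers the function from its box integrals. The energy form is treated as
  positive semidefinite only, a sign that has to be derived from the eigenvalue condition on the
  diffusion. The constants: testing with \<open>y\<close>, respectively \<open>s\<close>, leaves one
  unconverted factor of the norm to be bounded, which cancels, so (PRE) is paid once in each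
  direction. In \<open>Ceq\<close>, the entry 1 covers the estimator term and \<open>Cstab\<close>
  is the price of exchanging Galerkin solution and iterate in the estimator; the extra 1 in
  \<open>1 + Cstab\<close> is the algebraic error itself. \<open>Crel'\<close> comes from the
  triangle inequality through the Galerkin solution.\<close>

definition flat_exp :: "nat \<Rightarrow> real \<Rightarrow> real" where
  "flat_exp k t = (if 0 < t then inverse t ^ k * exp (- inverse t) else 0)"

text \<open>Substituting the reciprocal of \<open>t\<close> leaves the decay of
  \<open>s ^ k / exp s\<close> at infinity.\<close>

lemma flat_exp_tendsto_0: "(flat_exp k \<longlongrightarrow> 0) (at_right 0)"
proof -
  have "((\<lambda>t::real. inverse t ^ k / exp (inverse t)) \<longlongrightarrow> 0) (at_right 0)"
    using filterlim_compose[OF tendsto_power_div_exp_0 filterlim_inverse_at_top_right] .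
  then show ?thesis
    by (rule Lim_transform_eventually)
       (rule eventually_mono[OF eventually_at_right_less], simp add: flat_exp_def exp_minus divide_inverse)
qed

text \<open>Differentiating \<open>exp (- inverse t)\<close> produces powers of
  \<open>inverse t\<close>. With the exponent as an index, the family is closed under
  differentiation up to linear combinations, also at 0.\<close>

lemma flat_exp_has_derivative:
  "(flat_exp k has_real_derivative flat_exp (k + 2) t - real k * flat_exp (k + 1) t) (at t)"
proof -
  consider "t > 0" | "t < 0" | "t = 0" by linarith
  then show ?thesis
  proof cases
    case 1
    have "((\<lambda>t. inverse t ^ k * exp (- inverse t)) has_real_derivative
        flat_exp (k + 2) t - real k * flat_exp (k + 1) t) (at t)"
    proof -
      have "((\<lambda>t. inverse t ^ k * exp (- inverse t)) has_real_derivative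
          real k * inverse t ^ (k - 1) * (- (inverse t)\<^sup>2) * exp (- inverse t)
            + inverse t ^ k * (exp (- inverse t) * (inverse t)\<^sup>2)) (at t)"
        using 1 by (auto intro!: derivative_eq_intros simp: power2_eq_square)
      also have "real k * inverse t ^ (k - 1) * (- (inverse t)\<^sup>2) * exp (- inverse t)
            + inverse t ^ k * (exp (- inverse t) * (inverse t)\<^sup>2)
          = flat_exp (k + 2) t - real k * flat_exp (k + 1) t"
        using 1 by (cases k) (auto simp: flat_exp_def power2_eq_square algebra_simps)
      finally show ?thesis .
    qed
    then show ?thesis
      by (rule has_field_derivative_transform_within_open[where S="{0<..}"])
         (use 1 in \<open>auto simp: flat_exp_def\<close>)
  next
    case 2
    have "((\<lambda>_. 0) has_real_derivative 0) (at t)" by simp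
    then have "(flat_exp k has_real_derivative 0) (at t)"
      by (rule has_field_derivative_transform_within_open[where S="{..<0}"])
         (use 2 in \<open>auto simp: flat_exp_def\<close>)
    with 2 show ?thesis by (simp add: flat_exp_def)
  next
    case 3
    \<comment> \<open>At 0 the difference quotient from the right is
      \<open>flat_exp (Suc k)\<close>, so its limit is already known; from the left it is constantly
      0.\<close>
    have "((\<lambda>t. flat_exp k t / t) \<longlongrightarrow> 0) (at_right 0)"
      by (rule Lim_transform_eventually[OF flat_exp_tendsto_0[of "Suc k"]])
         (rule eventually_mono[OF eventually_at_right_less], simp add: flat_exp_def divide_inverse)
    moreover have "((\<lambda>t. flat_exp k t / t) \<longlongrightarrow> 0) (at_left 0)"
      by (rule Lim_transform_eventually[OF tendsto_const])
         (auto simp: flat_exp_def eventually_at_filter)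
    ultimately have "((\<lambda>t. flat_exp k t / t) \<longlongrightarrow> 0) (at 0)"
      by (simp add: filterlim_split_at)
    with 3 show ?thesis by (simp add: has_field_derivative_iff flat_exp_def)
  qed
qed

text \<open>
  An algebra of functions that contains the coordinate bumps and is closed under partial
  derivatives; hence its members are smooth.
\<close>

inductive bump_alg :: "(real ^ 'd::finite \<Rightarrow> real) \<Rightarrow> bool" where
  const: "bump_alg (\<lambda>x. c)"
| flat: "bump_alg (\<lambda>x. flat_exp k (m * x $ i + c))"
| add: "bump_alg f \<Longrightarrow> bump_alg g \<Longrightarrow> bump_alg (\<lambda>x. f x + g x)"
| mult: "bump_alg f \<Longrightarrow> bump_alg g \<Longrightarrow> bump_alg (\<lambda>x. f x * g x)"

lemma partial_eqI: "(f has_derivative f') (at x) \<Longrightarrow> partial i f x = f' (axis i 1)"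
  unfolding partial_def by (metis frechet_derivative_at)

text \<open>The induction carries the total derivative, since chain and product rule concern it
  rather than partial derivatives. Writing it in coordinates lets its components be required to lie
  in the algebra again.\<close>

lemma bump_alg_has_derivative:
  fixes f :: "real ^ 'd::finite \<Rightarrow> real"
  assumes "bump_alg f"
  shows "\<exists>g. (\<forall>i. bump_alg (g i)) \<and> (\<forall>x. (f has_derivative (\<lambda>h. \<Sum>i\<in>UNIV. g i x * h $ i)) (at x))"
  using assms
proof induction
  case (const c)
  show ?case
    by (rule exI[of _ "\<lambda>_ _. 0"]) (auto intro: bump_alg.intros)
next
  case (flat k m i c)
  \<comment> \<open>The factor \<open>m\<close> is the inner derivative. The difference is written
    as a sum with the constant factor \<open>- real k\<close> because the algebra has no rule for
    subtraction.\<close>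
  let ?e = "\<lambda>x::real^'d. m * (flat_exp (k + 2) (m * x $ i + c) + (- real k) * flat_exp (k + 1) (m * x $ i + c))"
  let ?g = "\<lambda>j. if j = i then ?e else (\<lambda>x. 0)"
  have "((\<lambda>x. flat_exp k (m * x $ i + c)) has_derivative (\<lambda>h. \<Sum>j\<in>UNIV. ?g j x * h $ j)) (at x)" for x
  proof -
    have *: "(\<Sum>j\<in>UNIV. ?g j x * h $ j) = ?e x * h $ i" for h
    proof -
      have "(\<Sum>j\<in>UNIV. ?g j x * h $ j) = (\<Sum>j\<in>UNIV. if j = i then ?e x * h $ j else 0)"
        by (intro sum.cong) auto
      also have "\<dots> = ?e x * h $ i" by simp
      finally show ?thesis .
    qed
    have "((\<lambda>x. m * x $ i + c) has_derivative (\<lambda>h. m * h $ i)) (at x)"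
      by (auto intro!: derivative_eq_intros bounded_linear_imp_has_derivative bounded_linear_vec_nth)
    from has_derivative_compose[OF this flat_exp_has_derivative[unfolded has_field_derivative_def]]
    show ?thesis unfolding * by (simp add: algebra_simps)
  qed
  moreover have "bump_alg (?g j)" for j
  proof (cases "j = i")
    case True
    have "bump_alg ?e" by (rule bump_alg.intros)+
    with True show ?thesis by simp
  qed (simp add: bump_alg.const)
  ultimately show ?case by (intro exI[of _ ?g] conjI allI)
next
  case (add f g)
  then obtain f' g' where d:
    "\<And>i. bump_alg (f' i)" "\<And>x. (f has_derivative (\<lambda>h. \<Sum>i\<in>UNIV. f' i x * h $ i)) (at x)"
    "\<And>i. bump_alg (g' i)" "\<And>x. (g has_derivative (\<lambda>h. \<Sum>i\<in>UNIV. g' i x * h $ i)) (at x)"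
    by blast
  have "((\<lambda>x. f x + g x) has_derivative (\<lambda>h. \<Sum>i\<in>UNIV. (f' i x + g' i x) * h $ i)) (at x)" for x
    using has_derivative_add[OF d(2)[of x] d(4)[of x]] by (simp add: distrib_right sum.distrib)
  moreover have "bump_alg (\<lambda>x. f' i x + g' i x)" for i
    by (rule bump_alg.add[OF d(1) d(3)])
  ultimately show ?case
    by (intro exI[of _ "\<lambda>i x. f' i x + g' i x"]) simp
next
  case (mult f g)
  then obtain f' g' where d:
    "\<And>i. bump_alg (f' i)" "\<And>x. (f has_derivative (\<lambda>h. \<Sum>i\<in>UNIV. f' i x * h $ i)) (at x)"
    "\<And>i. bump_alg (g' i)" "\<And>x. (g has_derivative (\<lambda>h. \<Sum>i\<in>UNIV. g' i x * h $ i)) (at x)"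
    by blast
  have "((\<lambda>x. f x * g x) has_derivative (\<lambda>h. \<Sum>i\<in>UNIV. (f x * g' i x + f' i x * g x) * h $ i)) (at x)" for x
    using has_derivative_mult[OF d(2)[of x] d(4)[of x]]
    by (simp add: distrib_right distrib_left sum.distrib sum_distrib_left mult_ac)
  moreover have "bump_alg (\<lambda>x. f x * g' i x + f' i x * g x)" for i
    by (rule bump_alg.add[OF bump_alg.mult[OF mult.hyps(1) d(3)] bump_alg.mult[OF d(1) mult.hyps(2)]])
  ultimately show ?case
    by (intro exI[of _ "\<lambda>i x. f x * g' i x + f' i x * g x"]) simp
qed

lemma bump_alg_partial:
  assumes "bump_alg f"
  shows "bump_alg (partial i f)"
proof -
  obtain g where g: "\<And>i. bump_alg (g i)"
    "\<And>x. (f has_derivative (\<lambda>h. \<Sum>i\<in>UNIV. g i x * h $ i)) (at x)"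
    using bump_alg_has_derivative[OF assms] by blast
  have "partial i f = g i"
  proof
    fix x
    have "partial i f x = (\<Sum>j\<in>UNIV. g j x * axis i 1 $ j)"
      using partial_eqI[OF g(2)] .
    also have "\<dots> = g i x"
      by (simp add: axis_def if_distrib[of "\<lambda>z. _ * z"] cong: if_cong)
    finally show "partial i f x = g i x" .
  qed
  with g(1) show ?thesis by simp
qed

lemma bump_alg_smooth:
  assumes "bump_alg f"
  shows "smooth f"
proof -
  have "bump_alg (iter_partial is f)" for "is"
    by (induction "is") (auto simp: assms bump_alg_partial)
  then show ?thesis
    unfolding smooth_def differentiable_def using bump_alg_has_derivative by blast
qed

lemma bump_alg_prod: "finite I \<Longrightarrow> (\<And>i. i \<in> I \<Longrightarrow> bump_alg (f i)) \<Longrightarrow> bump_alg (\<lambda>x. \<Prod>i\<in>I. f i x)"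
  by (induction I rule: finite_induct) (simp_all add: bump_alg.const bump_alg.mult)

text \<open>On the box the exponents tend to 0, so these test functions increase to its indicator.\<close>

definition box_bump :: "real ^ 'd \<Rightarrow> real ^ 'd \<Rightarrow> nat \<Rightarrow> real ^ 'd::finite \<Rightarrow> real" where
  "box_bump a b n x =
     (\<Prod>i\<in>UNIV. flat_exp 0 (real (Suc n) * (x $ i - a $ i)) * flat_exp 0 (real (Suc n) * (b $ i - x $ i)))"

lemma flat_exp_0_bounds: "0 \<le> flat_exp 0 t" "flat_exp 0 t \<le> 1"
  by (auto simp: flat_exp_def)

lemma box_bump_bounds: "0 \<le> box_bump a b n x" "box_bump a b n x \<le> 1"
  unfolding box_bump_def
  by (auto intro!: prod_nonneg prod_le_1 mult_nonneg_nonneg mult_le_one flat_exp_0_bounds)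

lemma box_bump_eq_0: "x \<notin> box a b \<Longrightarrow> box_bump a b n x = 0"
  unfolding box_bump_def mem_box_cart
  by (rule prod_zero) (auto simp: flat_exp_def zero_less_mult_iff)

lemma box_bump_tendsto: "(\<lambda>n. box_bump a b n x) \<longlonglongrightarrow> indicator (box a b) x"
proof (cases "x \<in> box a b")
  case True
  have 1: "(\<lambda>n. flat_exp 0 (real (Suc n) * s)) \<longlonglongrightarrow> 1" if "0 < s" for s
  proof -
    have "(\<lambda>n. exp (- (inverse (real (Suc n)) * inverse s))) \<longlonglongrightarrow> exp (- (0 * inverse s))"
      by (intro tendsto_intros LIMSEQ_inverse_real_of_nat)
    moreover have "flat_exp 0 (real (Suc n) * s) = exp (- (inverse (real (Suc n)) * inverse s))" for n
      using that by (simp add: flat_exp_def zero_less_mult_iff del: of_nat_Suc)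
    ultimately show ?thesis by simp
  qed
  have "(\<lambda>n. box_bump a b n x) \<longlonglongrightarrow> (\<Prod>i\<in>(UNIV::'a set). 1 * 1)"
    unfolding box_bump_def using True by (intro tendsto_intros 1) (auto simp: mem_box_cart)
  with True show ?thesis by simp
next
  case False
  then show ?thesis by (simp add: box_bump_eq_0)
qed

lemma test_fun_box_bump:
  assumes "cbox a b \<subseteq> U"
  shows "test_fun U (box_bump a b n)"
proof -
  have "bump_alg (box_bump a b n)"
    unfolding box_bump_def
  proof (intro bump_alg_prod bump_alg.mult)
    fix i :: 'a
    show "bump_alg (\<lambda>x. flat_exp 0 (real (Suc n) * (x $ i - a $ i)))"
      using bump_alg.flat[of 0 "real (Suc n)" i "- (real (Suc n) * a $ i)"] by (simp add: algebra_simps)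
    show "bump_alg (\<lambda>x. flat_exp 0 (real (Suc n) * (b $ i - x $ i)))"
      using bump_alg.flat[of 0 "- real (Suc n)" i "real (Suc n) * b $ i"] by (simp add: algebra_simps)
  qed simp
  moreover have "x \<notin> cbox a b \<Longrightarrow> box_bump a b n x = 0" for x
    using box_bump_eq_0[of x a b n] box_subset_cbox[of a b] by auto
  ultimately show ?thesis
    unfolding test_fun_def using assms
    by (intro conjI exI[of _ "cbox a b"] bump_alg_smooth) auto
qed

section \<open>Uniqueness and linearity of weak gradients\<close>

lemma box_bump_continuous: "continuous_on S (box_bump a b n)"
proof -
  have "\<And>x. box_bump a b n differentiable (at x)"
    using test_fun_box_bump[of a b UNIV n] iter_partial.simps(1) unfolding test_fun_def smooth_def
    by (metis subset_UNIV)
  then show ?thesis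
    by (meson continuous_at_imp_continuous_on differentiable_imp_continuous_within)
qed

text \<open>Local integrability speaks of compact sets, weak derivatives of integrals over all of
  \<open>U\<close>. For integrands supported in a compact set this passes between the two.\<close>

lemma integrable_lebesgue_on_extend:
  fixes f :: "real ^ 'd::finite \<Rightarrow> real"
  assumes "C \<in> sets lebesgue" "U \<in> sets lebesgue" "C \<subseteq> U" "\<And>x. x \<notin> C \<Longrightarrow> f x = 0"
  shows "integrable (lebesgue_on U) f \<longleftrightarrow> integrable (lebesgue_on C) f"
    and "(\<integral>x. f x \<partial>lebesgue_on U) = (\<integral>x. f x \<partial>lebesgue_on C)"
proof -
  have *: "(\<lambda>x. if x \<in> U then f x else 0) = (\<lambda>x. if x \<in> C then f x else 0)"
    using assms(3,4) by (intro ext) auto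
  show "integrable (lebesgue_on U) f \<longleftrightarrow> integrable (lebesgue_on C) f"
    using Lebesgue_Measure.integrable_restrict_UNIV[OF assms(1), of f]
      Lebesgue_Measure.integrable_restrict_UNIV[OF assms(2), of f] * by simp
  show "(\<integral>x. f x \<partial>lebesgue_on U) = (\<integral>x. f x \<partial>lebesgue_on C)"
    using Lebesgue_Measure.integral_restrict_UNIV[OF assms(1), of f]
      Lebesgue_Measure.integral_restrict_UNIV[OF assms(2), of f] * by simp
qed

lemma integrable_mult_bounded:
  fixes f g :: "'a \<Rightarrow> real"
  assumes f: "integrable M f" and g: "g \<in> borel_measurable M" and B: "AE x in M. \<bar>g x\<bar> \<le> B"
  shows "integrable M (\<lambda>x. f x * g x)"
proof (rule Bochner_Integration.integrable_bound[where f = "\<lambda>x. B * f x"])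
  show "AE x in M. norm (f x * g x) \<le> norm (B * f x)"
    using B
  proof eventually_elim
    case (elim x)
    then have "\<bar>f x\<bar> * \<bar>g x\<bar> \<le> \<bar>f x\<bar> * \<bar>B\<bar>" by (intro mult_left_mono) auto
    then show ?case by (simp add: abs_mult mult.commute)
  qed
qed (use f g in auto)

text \<open>A continuous factor is bounded on the compact set carrying it. This applies to a test
  function and to its partial derivatives, so that integrals against them may be split.\<close>

lemma integrable_loc_integrable_mult:
  fixes f \<phi> :: "real ^ 'd::finite \<Rightarrow> real"
  assumes U: "U \<in> sets lebesgue" and f: "loc_integrable U f" and C: "compact C" "C \<subseteq> U"
    and \<phi>: "continuous_on UNIV \<phi>" "\<And>x. x \<notin> C \<Longrightarrow> \<phi> x = 0"
  shows "integrable (lebesgue_on U) (\<lambda>x. f x * \<phi> x)"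
proof -
  have C': "C \<in> sets lebesgue" using C(1) by (simp add: compact_imp_closed borel_closed)
  have cC: "continuous_on C \<phi>" using \<phi>(1) continuous_on_subset by blast
  then have "bounded (\<phi> ` C)"
    using C(1) compact_continuous_image compact_imp_bounded by blast
  then obtain B where B: "\<And>x. x \<in> C \<Longrightarrow> \<bar>\<phi> x\<bar> \<le> B"
    unfolding bounded_iff by auto
  have "integrable (lebesgue_on C) (\<lambda>x. f x * \<phi> x)"
  proof (rule integrable_mult_bounded)
    show "integrable (lebesgue_on C) f" using f C unfolding loc_integrable_def by blast
    show "\<phi> \<in> borel_measurable (lebesgue_on C)"
      by (rule continuous_imp_measurable_on_sets_lebesgue[OF cC C'])
    show "AE x in lebesgue_on C. \<bar>\<phi> x\<bar> \<le> B" using B by (auto intro!: AE_I2)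
  qed
  then show ?thesis
    using integrable_lebesgue_on_extend(1)[OF C' U C(2)] \<phi>(2) by simp
qed

text \<open>Dominated convergence, with majorant \<open>\<bar>f x\<bar>\<close>, along the box
  bumps. The limit is the indicator of the open box, which differs from the closed one by a
  negligible frontier. The conclusion uses the gauge integral, the one for which differentiation of
  integrals is applied next.\<close>

lemma integral_cbox_eq_0:
  fixes f :: "real ^ 'd::finite \<Rightarrow> real"
  assumes U: "U \<in> sets lebesgue" and f: "loc_integrable U f" and sub: "cbox a b \<subseteq> U"
    and test: "\<And>\<phi>. test_fun U \<phi> \<Longrightarrow> (\<integral>x. f x * \<phi> x \<partial>lebesgue_on U) = 0"
  shows "integral (cbox a b) f = 0"
proof -
  let ?M = "lebesgue_on (cbox a b)"
  have C: "cbox a b \<in> sets lebesgue" by simp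
  have fi: "integrable ?M f"
    using f sub unfolding loc_integrable_def by (simp add: compact_cbox)
  have bump0: "box_bump a b n x = 0" if "x \<notin> cbox a b" for n x
    using that box_bump_eq_0[of x a b n] box_subset_cbox[of a b] by auto
  have z: "(\<integral>x. f x * box_bump a b n x \<partial>?M) = 0" for n
    using test[OF test_fun_box_bump[OF sub], of n]
      integrable_lebesgue_on_extend(2)[OF C U sub, of "\<lambda>x. f x * box_bump a b n x"] bump0 by simp
  have ind: "integrable ?M (\<lambda>x. f x * indicator (box a b) x)"
  proof (rule integrable_mult_bounded[OF fi])
    show "indicator (box a b) \<in> borel_measurable ?M"
      by (intro measurable_restrict_space1 borel_measurable_indicator) simp
    show "AE x in ?M. \<bar>indicator (box a b) x\<bar> \<le> (1::real)" by (simp add: indicator_def)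
  qed
  have "(\<lambda>n. \<integral>x. f x * box_bump a b n x \<partial>?M) \<longlonglongrightarrow> (\<integral>x. f x * indicator (box a b) x \<partial>?M)"
  proof (rule integral_dominated_convergence[where w = "\<lambda>x. \<bar>f x\<bar>"])
    show "AE x in ?M. (\<lambda>n. f x * box_bump a b n x) \<longlonglongrightarrow> f x * indicator (box a b) x"
      by (intro AE_I2 tendsto_intros box_bump_tendsto)
    show "AE x in ?M. norm (f x * box_bump a b n x) \<le> \<bar>f x\<bar>" for n
      using box_bump_bounds[of a b n] by (intro AE_I2) (simp add: abs_mult mult_left_le)
    show "(\<lambda>x. f x * box_bump a b n x) \<in> borel_measurable ?M" for n
      by (rule borel_measurable_times[OF borel_measurable_integrable[OF fi]
          continuous_imp_measurable_on_sets_lebesgue[OF box_bump_continuous C]])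
  qed (use fi ind in auto)
  then have "(\<integral>x. f x * indicator (box a b) x \<partial>?M) = 0"
    by (simp add: z LIMSEQ_const_iff)
  then have "integral (cbox a b) (\<lambda>x. f x * indicator (box a b) x) = 0"
    using lebesgue_integral_eq_integral[OF ind C] by simp
  also have "integral (cbox a b) (\<lambda>x. f x * indicator (box a b) x) = integral (cbox a b) f"
    by (rule integral_spike[OF negligible_frontier_interval[of a b]]) (auto simp: indicator_def)
  finally show ?thesis .
qed

text \<open>Lebesgue differentiation: at almost every point the value is the limit of averages over
  shrinking cubes with a corner there, and all these averages vanish.\<close>

lemma integrals_cbox_eq_0_imp_negligible:
  fixes f :: "'a::euclidean_space \<Rightarrow> real"
  assumes int: "f integrable_on cbox a b"
    and zero: "\<And>c d. cbox c d \<subseteq> cbox a b \<Longrightarrow> integral (cbox c d) f = 0"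
  shows "negligible {x \<in> cbox a b. f x \<noteq> 0}"
proof -
  \<comment> \<open>Extension by zero, because the differentiation theorem asks for integrability on
    every box.\<close>
  define F where "F x = (if x \<in> cbox a b then f x else 0)" for x
  have "F integrable_on UNIV"
    unfolding F_def using int by (simp add: Henstock_Kurzweil_Integration.integrable_restrict_UNIV)
  then have "F integrable_on cbox c d" for c d
    by (rule integrable_on_subcbox) simp
  then obtain N where N: "negligible N"
    "\<And>x e. \<lbrakk>x \<notin> N; 0 < e\<rbrakk> \<Longrightarrow> \<exists>d>0. \<forall>h. 0 < h \<and> h < d \<longrightarrow>
       norm (integral (cbox x (x + h *\<^sub>R One)) F /\<^sub>R h ^ DIM('a) - F x) < e"
    using integrable_ccontinuous_explicit by blast
  have "f x = 0" if x: "x \<in> box a b" "x \<notin> N" for x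
  proof (rule ccontr)
    assume nz: "f x \<noteq> 0"
    obtain r where r: "r > 0" "ball x r \<subseteq> box a b"
      using x(1) open_box open_contains_ball by blast
    obtain d where d: "d > 0" "\<And>h. 0 < h \<and> h < d \<Longrightarrow>
       norm (integral (cbox x (x + h *\<^sub>R One)) F /\<^sub>R h ^ DIM('a) - F x) < \<bar>f x\<bar>"
      using N(2)[OF x(2), of "\<bar>f x\<bar>"] nz by auto
    have pos: "norm (One::'a) > 0" by simp
    \<comment> \<open>The side is below \<open>d\<close>, so the average is within
      \<open>\<bar>f x\<bar>\<close> of \<open>f x\<close>, and the diagonal
      \<open>h * norm One\<close> is below \<open>r\<close>, so the cube stays in the box, where the
      average is 0.\<close>
    define h where "h = min (d / 2) (r / (2 * norm (One::'a)))"
    have h: "0 < h" "h < d" "h * norm (One::'a) < r"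
      using d(1) r(1) pos by (auto simp: h_def min_def field_simps)
    have "cbox x (x + h *\<^sub>R One) \<subseteq> ball x r"
    proof
      fix y assume y: "y \<in> cbox x (x + h *\<^sub>R One)"
      have "norm (y - x) \<le> norm (h *\<^sub>R (One::'a))"
        by (rule norm_le_componentwise)
           (use y h(1) in \<open>auto simp: mem_box inner_diff_left inner_add_left\<close>)
      with h show "y \<in> ball x r" by (simp add: dist_norm norm_minus_commute)
    qed
    then have sub: "cbox x (x + h *\<^sub>R One) \<subseteq> cbox a b"
      using r(2) box_subset_cbox[of a b] by blast
    have "integral (cbox x (x + h *\<^sub>R One)) F = integral (cbox x (x + h *\<^sub>R One)) f"
      by (rule Henstock_Kurzweil_Integration.integral_cong) (use sub in \<open>auto simp: F_def\<close>)
    with zero[OF sub] d(2)[of h] h x(1) show False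
      using box_subset_cbox[of a b] by (auto simp: F_def)
  qed
  then have "{x \<in> cbox a b. f x \<noteq> 0} \<subseteq> N \<union> (cbox a b - box a b)" by blast
  then show ?thesis
    using N(1) negligible_frontier_interval negligible_Un negligible_subset by blast
qed

lemma AE_lebesgue_on_iff_negligible:
  assumes "U \<in> sets lebesgue"
  shows "(AE x in lebesgue_on U. P x) \<longleftrightarrow> negligible {x \<in> U. \<not> P x}"
proof -
  have "(AE x in lebesgue_on U. P x) \<longleftrightarrow> (AE x in lebesgue. x \<in> U \<longrightarrow> P x)"
    using assms by (simp add: AE_restrict_space_iff)
  also have "\<dots> \<longleftrightarrow> {x \<in> U. \<not> P x} \<in> null_sets lebesgue"
    by (simp add: completion.AE_iff_null_sets)
  finally show ?thesis by (simp add: negligible_iff_null_sets)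
qed

text \<open>Local integrability controls compact pieces only, hence the cover of \<open>U\<close> by
  countably many closed boxes: countably many negligible exceptional sets have a negligible
  union.\<close>

lemma fundamental_lemma_calculus_of_variations:
  fixes f :: "real ^ 'd::finite \<Rightarrow> real"
  assumes U: "open U" and f: "loc_integrable U f"
    and test: "\<And>\<phi>. test_fun U \<phi> \<Longrightarrow> (\<integral>x. f x * \<phi> x \<partial>lebesgue_on U) = 0"
  shows "AE x in lebesgue_on U. f x = 0"
proof -
  have U': "U \<in> sets lebesgue" using U by simp
  obtain \<D> where \<D>: "countable \<D>" "\<D> \<subseteq> Pow U" "\<And>X. X \<in> \<D> \<Longrightarrow> \<exists>a b. X = cbox a b" "\<Union>\<D> = U"
    using open_countable_Union_open_cbox[OF U] by blast
  have "negligible {x \<in> X. f x \<noteq> 0}" if X: "X \<in> \<D>" for X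
  proof -
    obtain a b where ab: "X = cbox a b" using \<D>(3) X by blast
    have "cbox a b \<subseteq> U" using \<D>(2) X ab by blast
    then have "f integrable_on cbox a b" "\<And>c d. cbox c d \<subseteq> cbox a b \<Longrightarrow> integral (cbox c d) f = 0"
      using f integral_cbox_eq_0[OF U' f _ test]
      by (auto simp: loc_integrable_def compact_cbox intro!: integrable_on_lebesgue_on)
    then show ?thesis unfolding ab by (rule integrals_cbox_eq_0_imp_negligible)
  qed
  then have "negligible (\<Union>X\<in>\<D>. {x \<in> X. f x \<noteq> 0})"
    using \<D>(1) by (intro negligible_countable_Union) auto
  moreover have "(\<Union>X\<in>\<D>. {x \<in> X. f x \<noteq> 0}) = {x \<in> U. f x \<noteq> 0}" using \<D>(4) by blast
  ultimately show ?thesis using U' by (simp add: AE_lebesgue_on_iff_negligible)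
qed

section \<open>Linear combinations of weak gradients\<close>

lemma loc_integrable_lincomb:
  assumes "loc_integrable U f" "loc_integrable U g"
  shows "loc_integrable U (\<lambda>x. \<alpha> *\<^sub>R f x + \<beta> *\<^sub>R g x)"
  using assms unfolding loc_integrable_def
  by (auto intro!: Bochner_Integration.integrable_add integrable_scaleR_right)

lemma loc_integrable_component:
  "loc_integrable U g \<Longrightarrow> loc_integrable U (\<lambda>x. g x $ i)"
  unfolding loc_integrable_def
  by (auto intro!: integrable_bounded_linear[OF bounded_linear_vec_nth])

lemma test_fun_partial:
  assumes "test_fun U \<phi>"
  obtains C where "compact C" "C \<subseteq> U" "continuous_on UNIV \<phi>" "continuous_on UNIV (partial i \<phi>)"
    "\<And>x. x \<notin> C \<Longrightarrow> \<phi> x = 0" "\<And>x. x \<notin> C \<Longrightarrow> partial i \<phi> x = 0"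
proof -
  obtain C where C: "compact C" "C \<subseteq> U" "\<And>x. x \<notin> C \<Longrightarrow> \<phi> x = 0"
    using assms unfolding test_fun_def by blast
  have d: "iter_partial is \<phi> differentiable (at x)" for "is" x
    using assms unfolding test_fun_def smooth_def by blast
  have cont: "continuous_on UNIV (iter_partial is \<phi>)" for "is"
    by (meson continuous_at_imp_continuous_on differentiable_imp_continuous_within d)
  have "partial i \<phi> x = 0" if "x \<notin> C" for x
  proof -
    have "(\<phi> has_derivative (\<lambda>_. 0)) (at x)"
      by (rule has_derivative_transform_within_open[OF has_derivative_const, of "- C" _ 0])
         (use C that in \<open>auto simp: compact_imp_closed open_Compl\<close>)
    from partial_eqI[OF this] show ?thesis .
  qed
  with C cont[of "[]"] cont[of "[i]"] show ?thesis by (intro that[of C]) auto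
qed

lemma weak_grad_lincomb:
  assumes U: "U \<in> sets lebesgue" and v: "weak_grad U v g" and w: "weak_grad U w h"
  shows "weak_grad U (\<lambda>x. \<alpha> * v x + \<beta> * w x) (\<lambda>x. \<alpha> *\<^sub>R g x + \<beta> *\<^sub>R h x)"
  unfolding weak_grad_def
proof (intro conjI allI impI)
  have loc: "loc_integrable U v" "loc_integrable U w" "loc_integrable U g" "loc_integrable U h"
    using v w unfolding weak_grad_def by auto
  show "loc_integrable U (\<lambda>x. \<alpha> * v x + \<beta> * w x)"
    using loc_integrable_lincomb[OF loc(1,2)] by simp
  show "loc_integrable U (\<lambda>x. \<alpha> *\<^sub>R g x + \<beta> *\<^sub>R h x)"
    using loc_integrable_lincomb[OF loc(3,4)] by simp
  fix \<phi> i assume \<phi>: "test_fun U \<phi>"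
  obtain C where C: "compact C" "C \<subseteq> U" "continuous_on UNIV \<phi>" "continuous_on UNIV (partial i \<phi>)"
    "\<And>x. x \<notin> C \<Longrightarrow> \<phi> x = 0" "\<And>x. x \<notin> C \<Longrightarrow> partial i \<phi> x = 0"
    using test_fun_partial[OF \<phi>] by blast
  have I: "integrable (lebesgue_on U) (\<lambda>x. f x * \<phi> x)"
    "integrable (lebesgue_on U) (\<lambda>x. f x * partial i \<phi> x)" if "loc_integrable U f" for f
    using integrable_loc_integrable_mult[OF U that C(1,2)] C(3-6) by blast+
  note I' = I(2)[OF loc(1)] I(2)[OF loc(2)]
    I(1)[OF loc_integrable_component[OF loc(3)], of i] I(1)[OF loc_integrable_component[OF loc(4)], of i]
  have "(\<integral>x. (\<alpha> * v x + \<beta> * w x) * partial i \<phi> x \<partial>lebesgue_on U)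
      = (\<integral>x. \<alpha> * (v x * partial i \<phi> x) + \<beta> * (w x * partial i \<phi> x) \<partial>lebesgue_on U)"
    by (simp add: algebra_simps)
  also have "\<dots> = \<alpha> * (\<integral>x. v x * partial i \<phi> x \<partial>lebesgue_on U) + \<beta> * (\<integral>x. w x * partial i \<phi> x \<partial>lebesgue_on U)"
    using I' by simp
  also have "\<dots> = - (\<alpha> * (\<integral>x. g x $ i * \<phi> x \<partial>lebesgue_on U) + \<beta> * (\<integral>x. h x $ i * \<phi> x \<partial>lebesgue_on U))"
    using v w \<phi> unfolding weak_grad_def by simp
  also have "\<dots> = - (\<integral>x. \<alpha> * (g x $ i * \<phi> x) + \<beta> * (h x $ i * \<phi> x) \<partial>lebesgue_on U)"
    using I' by simp
  also have "\<dots> = - (\<integral>x. (\<alpha> *\<^sub>R g x + \<beta> *\<^sub>R h x) $ i * \<phi> x \<partial>lebesgue_on U)"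
    by (simp add: algebra_simps)
  finally show "(\<integral>x. (\<alpha> * v x + \<beta> * w x) * partial i \<phi> x \<partial>lebesgue_on U)
      = - (\<integral>x. (\<alpha> *\<^sub>R g x + \<beta> *\<^sub>R h x) $ i * \<phi> x \<partial>lebesgue_on U)" .
qed

text \<open>The difference of two weak gradients of one function is a weak gradient of the zero
  function, so each of its components integrates to 0 against every test function.\<close>

lemma weak_grad_unique:
  assumes U: "open U" and g: "weak_grad U v g" and h: "weak_grad U v h"
  shows "AE x in lebesgue_on U. g x = h x"
proof -
  have U': "U \<in> sets lebesgue" using U by simp
  have d: "weak_grad U (\<lambda>x. 0) (\<lambda>x. g x - h x)"
    using weak_grad_lincomb[OF U' g h, of 1 "-1"] by simp
  have "AE x in lebesgue_on U. (g x - h x) $ i = 0" for i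
  proof (rule fundamental_lemma_calculus_of_variations[OF U])
    show "loc_integrable U (\<lambda>x. (g x - h x) $ i)"
      using d loc_integrable_component unfolding weak_grad_def by blast
    show "(\<integral>x. (g x - h x) $ i * \<phi> x \<partial>lebesgue_on U) = 0" if \<phi>: "test_fun U \<phi>" for \<phi>
    proof -
      have "(\<integral>x. 0 * partial i \<phi> x \<partial>lebesgue_on U) = - (\<integral>x. (g x - h x) $ i * \<phi> x \<partial>lebesgue_on U)"
        using d \<phi> unfolding weak_grad_def by blast
      then show ?thesis by simp
    qed
  qed
  then have "AE x in lebesgue_on U. \<forall>i. (g x - h x) $ i = 0"
    by (simp add: AE_all_countable)
  then show ?thesis by eventually_elim (simp add: Finite_Cartesian_Product.vec_eq_iff)
qed

text \<open>Completeness of Lebesgue measure, applied after extending both functions by zero. An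
  arbitrarily chosen representative of a weak gradient thereby becomes measurable.\<close>

lemma borel_measurable_lebesgue_on_AE:
  fixes f g :: "'a::euclidean_space \<Rightarrow> 'b::euclidean_space"
  assumes U: "U \<in> sets lebesgue" and f: "f \<in> borel_measurable (lebesgue_on U)"
    and ae: "AE x in lebesgue_on U. f x = g x"
  shows "g \<in> borel_measurable (lebesgue_on U)"
proof -
  have *: "AE x in lebesgue. (if x \<in> U then f x else 0) = (if x \<in> U then g x else 0)"
    using ae U by (auto simp: AE_restrict_space_iff)
  have "(\<lambda>x. if x \<in> U then f x else 0) \<in> borel_measurable lebesgue"
    using f U by (simp add: borel_measurable_if)
  from borel_measurable_AE[OF this *]
  have "(\<lambda>x. if x \<in> U then g x else 0) \<in> borel_measurable lebesgue" .
  then show ?thesis using U by (simp add: borel_measurable_if)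
qed

section \<open>Square integrable and essentially bounded functions\<close>

lemma L2_measurable: "L2 U f \<Longrightarrow> f \<in> borel_measurable (lebesgue_on U)"
  and L2_integrable: "L2 U f \<Longrightarrow> integrable (lebesgue_on U) (\<lambda>x. (norm (f x))\<^sup>2)"
  unfolding L2_def by blast+

lemma L2_cong_AE:
  assumes U: "U \<in> sets lebesgue" and f: "L2 U f" and ae: "AE x in lebesgue_on U. f x = g x"
  shows "L2 U g"
proof -
  have g: "g \<in> borel_measurable (lebesgue_on U)"
    using borel_measurable_lebesgue_on_AE[OF U _ ae] f unfolding L2_def by blast
  have "integrable (lebesgue_on U) (\<lambda>x. (norm (g x))\<^sup>2)"
  proof (rule integrable_cong_AE_imp)
    show "integrable (lebesgue_on U) (\<lambda>x. (norm (f x))\<^sup>2)" using f unfolding L2_def by blast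
    show "AE x in lebesgue_on U. (norm (f x))\<^sup>2 = (norm (g x))\<^sup>2" using ae by eventually_elim simp
  qed (use g in measurable)
  with g show ?thesis unfolding L2_def by blast
qed

lemma integrable_L2_mult:
  fixes f g :: "real ^ 'd::finite \<Rightarrow> real"
  assumes "L2 U f" "L2 U g"
  shows "integrable (lebesgue_on U) (\<lambda>x. f x * g x)"
proof (rule Bochner_Integration.integrable_bound[where f = "\<lambda>x. (norm (f x))\<^sup>2 + (norm (g x))\<^sup>2"])
  show "integrable (lebesgue_on U) (\<lambda>x. (norm (f x))\<^sup>2 + (norm (g x))\<^sup>2)"
    by (intro Bochner_Integration.integrable_add L2_integrable assms)
  show "(\<lambda>x. f x * g x) \<in> borel_measurable (lebesgue_on U)"
    by (intro borel_measurable_times L2_measurable assms)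
  have "\<bar>a * b\<bar> \<le> a\<^sup>2 + b\<^sup>2" for a b :: real
  proof -
    have "2 * \<bar>a\<bar> * \<bar>b\<bar> \<le> a\<^sup>2 + b\<^sup>2"
      using sum_squares_bound[of "\<bar>a\<bar>" "\<bar>b\<bar>"] unfolding power2_abs .
    moreover have "0 \<le> \<bar>a\<bar> * \<bar>b\<bar>" by (intro mult_nonneg_nonneg abs_ge_zero)
    ultimately show ?thesis unfolding abs_mult by (simp only: mult.assoc)
  qed
  then show "AE x in lebesgue_on U. norm (f x * g x) \<le> norm ((norm (f x))\<^sup>2 + (norm (g x))\<^sup>2)"
    by (intro AE_I2) simp
qed

lemma L2_lincomb:
  assumes "L2 U f" "L2 U g"
  shows "L2 U (\<lambda>x. \<alpha> *\<^sub>R f x + \<beta> *\<^sub>R g x)"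
  unfolding L2_def
proof (intro conjI)
  show m: "(\<lambda>x. \<alpha> *\<^sub>R f x + \<beta> *\<^sub>R g x) \<in> borel_measurable (lebesgue_on U)"
    by (intro borel_measurable_add borel_measurable_scaleR borel_measurable_const L2_measurable assms)
  have b: "(norm (\<alpha> *\<^sub>R a + \<beta> *\<^sub>R b))\<^sup>2 \<le> 2 * \<alpha>\<^sup>2 * (norm a)\<^sup>2 + 2 * \<beta>\<^sup>2 * (norm b)\<^sup>2" for a b :: 'b
  proof -
    have "(norm (\<alpha> *\<^sub>R a + \<beta> *\<^sub>R b))\<^sup>2 \<le> (\<bar>\<alpha>\<bar> * norm a + \<bar>\<beta>\<bar> * norm b)\<^sup>2"
      using norm_triangle_ineq[of "\<alpha> *\<^sub>R a" "\<beta> *\<^sub>R b"] by (intro power_mono) auto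
    also have "\<dots> \<le> 2 * (\<bar>\<alpha>\<bar> * norm a)\<^sup>2 + 2 * (\<bar>\<beta>\<bar> * norm b)\<^sup>2"
      using sum_squares_bound[of "\<bar>\<alpha>\<bar> * norm a" "\<bar>\<beta>\<bar> * norm b"] by (simp add: power2_sum)
    finally show ?thesis by (simp add: power_mult_distrib)
  qed
  show "integrable (lebesgue_on U) (\<lambda>x. (norm (\<alpha> *\<^sub>R f x + \<beta> *\<^sub>R g x))\<^sup>2)"
  proof (rule Bochner_Integration.integrable_bound)
    show "integrable (lebesgue_on U) (\<lambda>x. 2 * \<alpha>\<^sup>2 * (norm (f x))\<^sup>2 + 2 * \<beta>\<^sup>2 * (norm (g x))\<^sup>2)"
      by (intro Bochner_Integration.integrable_add integrable_mult_right L2_integrable assms)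
    show "(\<lambda>x. (norm (\<alpha> *\<^sub>R f x + \<beta> *\<^sub>R g x))\<^sup>2) \<in> borel_measurable (lebesgue_on U)"
      using m by measurable
  qed (intro AE_I2, use b in simp)
qed

lemma borel_measurable_vec_nth:
  fixes g :: "'a \<Rightarrow> 'b::euclidean_space ^ 'n::finite"
  assumes "g \<in> borel_measurable M"
  shows "(\<lambda>x. g x $ i) \<in> borel_measurable M"
  by (rule measurable_compose[OF assms borel_measurable_continuous_onI])
     (intro continuous_intros)

lemma L2_component:
  assumes "L2 U g"
  shows "L2 U (\<lambda>x. g x $ i)"
  unfolding L2_def
proof (intro conjI)
  show m: "(\<lambda>x. g x $ i) \<in> borel_measurable (lebesgue_on U)"
    by (rule borel_measurable_vec_nth[OF L2_measurable[OF assms]])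
  show "integrable (lebesgue_on U) (\<lambda>x. (norm (g x $ i))\<^sup>2)"
  proof (rule Bochner_Integration.integrable_bound)
    show "integrable (lebesgue_on U) (\<lambda>x. (norm (g x))\<^sup>2)" by (rule L2_integrable[OF assms])
    show "AE x in lebesgue_on U. norm ((norm (g x $ i))\<^sup>2) \<le> norm ((norm (g x))\<^sup>2)"
      using power_mono[OF Finite_Cartesian_Product.norm_nth_le norm_ge_zero, of "g _" i 2]
      by (intro AE_I2) simp
  qed (use m in measurable)
qed

lemma Linf_component:
  assumes "Linf U q"
  shows "Linf U (\<lambda>x. q x $ i)"
proof -
  obtain C where C: "AE x in lebesgue_on U. norm (q x) \<le> C" using assms unfolding Linf_def by blast
  then have "AE x in lebesgue_on U. norm (q x $ i) \<le> C"
    by eventually_elim (rule order_trans[OF Finite_Cartesian_Product.norm_nth_le])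
  moreover have "(\<lambda>x. q x $ i) \<in> borel_measurable (lebesgue_on U)"
    using assms borel_measurable_vec_nth unfolding Linf_def by blast
  ultimately show ?thesis unfolding Linf_def by blast
qed

lemma integrable_Linf_L2_L2:
  fixes q f g :: "real ^ 'd::finite \<Rightarrow> real"
  assumes q: "Linf U q" and "L2 U f" "L2 U g"
  shows "integrable (lebesgue_on U) (\<lambda>x. q x * f x * g x)"
proof -
  obtain C where "AE x in lebesgue_on U. \<bar>q x\<bar> \<le> C" "q \<in> borel_measurable (lebesgue_on U)"
    using q unfolding Linf_def by auto
  from integrable_mult_bounded[OF integrable_L2_mult[OF assms(2,3)] this(2,1)]
  show ?thesis by (simp add: mult_ac)
qed

text \<open>\<open>H1\<close> provides some square integrable weak gradient, and the choice in
  \<open>wgrad\<close> may pick another one. By uniqueness the two agree almost everywhere, which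
  preserves \<open>L2\<close>.\<close>

lemma H1_wgrad:
  assumes U: "open U" and v: "H1 U v"
  shows "weak_grad U v (wgrad U v)" and "L2 U (wgrad U v)"
proof -
  obtain g where g: "weak_grad U v g" "L2 U g" using v unfolding H1_def by blast
  show w: "weak_grad U v (wgrad U v)" unfolding wgrad_def using someI[of "weak_grad U v", OF g(1)] by simp
  show "L2 U (wgrad U v)"
    using L2_cong_AE[OF _ g(2) weak_grad_unique[OF U g(1) w]] U by simp
qed

lemma H1_lincomb:
  assumes U: "open U" and "H1 U v" "H1 U w"
  shows "H1 U (\<lambda>x. \<alpha> * v x + \<beta> * w x)"
    and "AE x in lebesgue_on U.
      wgrad U (\<lambda>x. \<alpha> * v x + \<beta> * w x) x = \<alpha> *\<^sub>R wgrad U v x + \<beta> *\<^sub>R wgrad U w x"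
proof -
  note v = H1_wgrad[OF U assms(2)] and w = H1_wgrad[OF U assms(3)]
  have g: "weak_grad U (\<lambda>x. \<alpha> * v x + \<beta> * w x) (\<lambda>x. \<alpha> *\<^sub>R wgrad U v x + \<beta> *\<^sub>R wgrad U w x)"
    using weak_grad_lincomb[OF _ v(1) w(1)] U by simp
  have "L2 U (\<lambda>x. \<alpha> * v x + \<beta> * w x)"
    using L2_lincomb[of U v w \<alpha> \<beta>] assms unfolding H1_def by simp
  then show h: "H1 U (\<lambda>x. \<alpha> * v x + \<beta> * w x)"
    using g L2_lincomb[OF v(2) w(2)] unfolding H1_def by blast
  show "AE x in lebesgue_on U.
      wgrad U (\<lambda>x. \<alpha> * v x + \<beta> * w x) x = \<alpha> *\<^sub>R wgrad U v x + \<beta> *\<^sub>R wgrad U w x"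
    by (rule weak_grad_unique[OF U H1_wgrad(1)[OF U h] g])
qed

section \<open>Preconditioned norms and Krylov spaces\<close>

text \<open>The discriminant of a nonnegative quadratic polynomial. In terms of plain numbers it
  serves the preconditioner inner product, the energy form and the Rayleigh quotient alike, the
  degenerate case \<open>c = 0\<close> included.\<close>

lemma semi_inner_Cauchy_Schwarz:
  fixes a b c :: real
  assumes c: "0 \<le> c" and pos: "\<And>t. 0 \<le> a + 2 * t * b + t\<^sup>2 * c"
  shows "b\<^sup>2 \<le> a * c"
proof (cases "c = 0")
  case True
  have "b = 0"
  proof (rule ccontr)
    assume "b \<noteq> 0"
    \<comment> \<open>For \<open>c = 0\<close> the polynomial is affine in \<open>t\<close>; this
      \<open>t\<close> gives it the value -1.\<close>
    then have "a + 2 * (- (a + 1) / (2 * b)) * b = - 1" by (simp add: field_simps)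
    with pos[of "- (a + 1) / (2 * b)"] True show False by simp
  qed
  with True show ?thesis by simp
next
  case False
  with c have "c > 0" by simp
  \<comment> \<open>The minimizer of the quadratic.\<close>
  with pos[of "- b / c"] show ?thesis
    by (simp add: field_simps power2_eq_square)
qed

text \<open>\<open>pnorm\<close> contains \<open>the (mat_inverse P)\<close>, which means something
  only once an inverse exists. A nonzero kernel vector would contradict definiteness.\<close>

lemma spd_mat_inverse_exists:
  assumes P: "spd N P"
  obtains Q where "mat_inverse P = Some Q"
proof -
  have Pc: "P \<in> carrier_mat N N" using P unfolding spd_def by blast
  have det: "det P \<noteq> 0"
  proof
    assume "det P = 0"
    then obtain v where v: "v \<in> carrier_vec N" "v \<noteq> 0\<^sub>v N" "P *\<^sub>v v = 0\<^sub>v N"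
      using det_0_iff_vec_prod_zero_field[OF Pc] by blast
    then have "0 < scalar_prod v (P *\<^sub>v v)" using P unfolding spd_def by blast
    with v show False by simp
  qed
  have "mat_inverse P \<noteq> None"
    using mat_inverse(1)[OF Pc] det_non_zero_imp_unit[OF Pc det] by metis
  then show ?thesis using that by blast
qed

lemma spd_mat_inverse:
  assumes P: "spd N P" and Q: "mat_inverse P = Some Q"
  shows "Q \<in> carrier_mat N N"
    and "x \<in> carrier_vec N \<Longrightarrow> P *\<^sub>v (Q *\<^sub>v x) = x"
    and "x \<in> carrier_vec N \<Longrightarrow> Q *\<^sub>v (P *\<^sub>v x) = x"
proof -
  have Pc: "P \<in> carrier_mat N N" using P unfolding spd_def by blast
  have *: "P * Q = 1\<^sub>m N" "Q * P = 1\<^sub>m N" "Q \<in> carrier_mat N N"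
    using mat_inverse(2)[OF Pc Q] by auto
  show "Q \<in> carrier_mat N N" by fact
  assume x: "x \<in> carrier_vec N"
  show "P *\<^sub>v (Q *\<^sub>v x) = x" using assoc_mult_mat_vec[OF Pc *(3) x] *(1) x by simp
  show "Q *\<^sub>v (P *\<^sub>v x) = x" using assoc_mult_mat_vec[OF *(3) Pc x] *(2) x by simp
qed

text \<open>Substituting \<open>x = P *\<^sub>v (Q *\<^sub>v x)\<close> turns the form of the
  inverse into the form of \<open>P\<close> itself, evaluated at the images under
  \<open>Q\<close>.\<close>

lemma spd_inverse_form:
  assumes P: "spd N P" and Q: "mat_inverse P = Some Q" and x: "x \<in> carrier_vec N"
  shows "0 \<le> scalar_prod (Q *\<^sub>v x) x"
    and "y \<in> carrier_vec N \<Longrightarrow> scalar_prod (Q *\<^sub>v x) y = scalar_prod (Q *\<^sub>v y) x"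
proof -
  have Pc: "P \<in> carrier_mat N N" and Pt: "transpose_mat P = P" using P unfolding spd_def by auto
  note Qc = spd_mat_inverse(1)[OF P Q] and PQ = spd_mat_inverse(2)[OF P Q]
  have Qx: "Q *\<^sub>v x \<in> carrier_vec N" using Qc x by simp
  have "0 \<le> scalar_prod (Q *\<^sub>v x) (P *\<^sub>v (Q *\<^sub>v x))"
  proof (cases "Q *\<^sub>v x = 0\<^sub>v N")
    case True
    then show ?thesis using Pc by (simp add: scalar_prod_left_zero[of _ N])
  next
    case False
    then show ?thesis using P Qx unfolding spd_def by (meson less_imp_le)
  qed
  then show "0 \<le> scalar_prod (Q *\<^sub>v x) x" using PQ[OF x] by simp
  assume y: "y \<in> carrier_vec N"
  have Qy: "Q *\<^sub>v y \<in> carrier_vec N" using Qc y by simp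
  have "scalar_prod (Q *\<^sub>v x) y = scalar_prod (Q *\<^sub>v x) (P *\<^sub>v (Q *\<^sub>v y))"
    using PQ[OF y] by simp
  also have "\<dots> = scalar_prod (P *\<^sub>v (Q *\<^sub>v x)) (Q *\<^sub>v y)"
    using transpose_vec_mult_scalar[OF Pc Qy Qx] Pt by simp
  also have "\<dots> = scalar_prod (Q *\<^sub>v y) x"
    using PQ[OF x] comm_scalar_prod[OF x Qy] by simp
  finally show "scalar_prod (Q *\<^sub>v x) y = scalar_prod (Q *\<^sub>v y) x" .
qed

lemma pnorm_square:
  assumes P: "spd N P" and Q: "mat_inverse P = Some Q" and x: "x \<in> carrier_vec N"
  shows "(pnorm P x)\<^sup>2 = scalar_prod (Q *\<^sub>v x) x" and "0 \<le> pnorm P x"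
  using spd_inverse_form(1)[OF P Q x] Q by (simp_all add: pnorm_def)

lemma pnorm_Cauchy_Schwarz:
  assumes P: "spd N P" and Q: "mat_inverse P = Some Q"
    and x: "x \<in> carrier_vec N" and y: "y \<in> carrier_vec N"
  shows "scalar_prod (Q *\<^sub>v x) y \<le> pnorm P x * pnorm P y"
proof -
  note Qc = spd_mat_inverse(1)[OF P Q]
  let ?a = "scalar_prod (Q *\<^sub>v x) x" and ?b = "scalar_prod (Q *\<^sub>v x) y"
    and ?c = "scalar_prod (Q *\<^sub>v y) y"
  have Qx: "Q *\<^sub>v x \<in> carrier_vec N" and Qy: "Q *\<^sub>v y \<in> carrier_vec N" using Qc x y by auto
  have "0 \<le> ?a + 2 * t * ?b + t\<^sup>2 * ?c" for t
  proof -
    have z: "x + t \<cdot>\<^sub>v y \<in> carrier_vec N" using x y by simp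
    have "scalar_prod (Q *\<^sub>v (x + t \<cdot>\<^sub>v y)) (x + t \<cdot>\<^sub>v y)
        = scalar_prod (Q *\<^sub>v x + t \<cdot>\<^sub>v (Q *\<^sub>v y)) (x + t \<cdot>\<^sub>v y)"
      using Qc x y by (simp add: mult_add_distrib_mat_vec[of _ N N] mult_mat_vec[of _ N N])
    also have "\<dots> = scalar_prod (Q *\<^sub>v x) (x + t \<cdot>\<^sub>v y) + scalar_prod (t \<cdot>\<^sub>v (Q *\<^sub>v y)) (x + t \<cdot>\<^sub>v y)"
      by (rule add_scalar_prod_distrib[of _ N]) (use Qx Qy z in auto)
    also have "\<dots> = ?a + t * ?b + t * (scalar_prod (Q *\<^sub>v y) x + t * ?c)"
      using x y Qx Qy z
      by (simp add: scalar_prod_add_distrib[of _ N] smult_scalar_prod_distrib[of _ N]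
          scalar_prod_smult_distrib[of _ N] distrib_left)
    finally show ?thesis
      using spd_inverse_form(1)[OF P Q z] spd_inverse_form(2)[OF P Q x y]
      by (simp add: algebra_simps power2_eq_square)
  qed
  with spd_inverse_form(1)[OF P Q y] have "?b\<^sup>2 \<le> ?a * ?c"
    by (rule semi_inner_Cauchy_Schwarz)
  then have "\<bar>?b\<bar> \<le> sqrt (?a * ?c)" by (simp add: real_le_rsqrt)
  then show ?thesis using Q unfolding pnorm_def by (simp add: real_sqrt_mult)
qed

lemma krylov_carrier:
  assumes "P \<in> carrier_mat N N" "B \<in> carrier_mat N N" "s \<in> carrier_vec N"
  shows "krylov N P B s K \<subseteq> carrier_vec N"
proof -
  interpret V: vectorspace "class_ring :: real ring" "module_vec TYPE(real) N" by (rule vec_vs)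
  have "{((P * B) ^\<^sub>m i) *\<^sub>v s | i. i < K} \<subseteq> carrier (module_vec TYPE(real) N)"
    using mult_mat_vec_carrier[OF pow_carrier_mat[OF mult_carrier_mat[OF assms(1,2)]] assms(3)]
    by (auto simp: module_vec_simps)
  then show ?thesis
    unfolding krylov_def using V.span_closed by (auto simp: module_vec_simps)
qed

text \<open>Each iterate gets its dimension from its own step, without an induction over restarts: a
  matrix times a vector has as many entries as the matrix has rows, and a sum of vectors has the
  dimension of its second summand, here the Krylov correction.\<close>

lemma pgmres_step_carrier:
  assumes "P \<in> carrier_mat N N" "B \<in> carrier_mat N N" and "pgmres_step kmax N P B d xs k"
  shows "xs k \<in> carrier_vec N"
proof -
  obtain K m y where y: "y \<in> krylov N P B (presid P B d (xs m)) K" and xs: "xs k = xs m + y"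
    using assms(3) unfolding pgmres_step_def Let_def is_arg_min_def by blast
  have "presid P B d (xs m) \<in> carrier_vec N"
    using assms(1) unfolding presid_def carrier_vec_def by auto
  then have "y \<in> carrier_vec N" using krylov_carrier[OF assms(1,2)] y by blast
  then show ?thesis using xs unfolding carrier_vec_def by simp
qed

section \<open>The bilinear forms\<close>

text \<open>
  Both bilinear forms integrate an expression that is pointwise bilinear in the pair of weak gradient
  and value, and this pair depends linearly on the function, though only almost everywhere.
\<close>

definition jet :: "(real ^ 'd::finite) set \<Rightarrow> (real ^ 'd \<Rightarrow> real) \<Rightarrow> real ^ 'd \<Rightarrow> (real ^ 'd) \<times> real" where
  "jet U v x = (wgrad U v x, v x)"

lemma jet_lincomb:
  assumes "open U" "H1 U v" "H1 U w"
  shows "AE x in lebesgue_on U.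
    jet U (\<lambda>x. \<alpha> * v x + \<beta> * w x) x = \<alpha> *\<^sub>R jet U v x + \<beta> *\<^sub>R jet U w x"
  using H1_lincomb(2)[OF assms, of \<alpha> \<beta>] by eventually_elim (simp add: jet_def)

definition jet_form ::
  "(real ^ 'd::finite) set \<Rightarrow> (real ^ 'd \<Rightarrow> (real ^ 'd) \<times> real \<Rightarrow> (real ^ 'd) \<times> real \<Rightarrow> real) \<Rightarrow>
    (real ^ 'd \<Rightarrow> real) \<Rightarrow> (real ^ 'd \<Rightarrow> real) \<Rightarrow> real" where
  "jet_form U \<beta> v w = (\<integral>x. \<beta> x (jet U v x) (jet U w x) \<partial>lebesgue_on U)"

text \<open>Integrability is bundled with pointwise bilinearity because the Bochner integral is
  additive only on integrable functions.\<close>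

definition jet_bilinear ::
  "(real ^ 'd::finite) set \<Rightarrow> (real ^ 'd \<Rightarrow> (real ^ 'd) \<times> real \<Rightarrow> (real ^ 'd) \<times> real \<Rightarrow> real) \<Rightarrow> bool" where
  "jet_bilinear U \<beta> \<longleftrightarrow> (\<forall>x. bilinear (\<beta> x)) \<and>
     (\<forall>v w. H1 U v \<longrightarrow> H1 U w \<longrightarrow> integrable (lebesgue_on U) (\<lambda>x. \<beta> x (jet U v x) (jet U w x)))"

text \<open>Rules for the second argument follow from those for the first by exchanging the
  arguments. Symmetry is no substitute, as convection makes \<open>b_form\<close> nonsymmetric in
  general.\<close>

lemma jet_bilinear_flip: "jet_bilinear U \<beta> \<Longrightarrow> jet_bilinear U (\<lambda>x p q. \<beta> x q p)"
  unfolding jet_bilinear_def bilinear_def by auto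

lemma jet_form_lincomb_left:
  assumes U: "open U" and \<beta>: "jet_bilinear U \<beta>" and v: "H1 U v" and w: "H1 U w" and z: "H1 U z"
  shows "jet_form U \<beta> (\<lambda>x. a * v x + c * w x) z = a * jet_form U \<beta> v z + c * jet_form U \<beta> w z"
proof -
  have I: "integrable (lebesgue_on U) (\<lambda>x. \<beta> x (jet U v x) (jet U z x))"
    "integrable (lebesgue_on U) (\<lambda>x. \<beta> x (jet U w x) (jet U z x))"
    "integrable (lebesgue_on U) (\<lambda>x. \<beta> x (jet U (\<lambda>x. a * v x + c * w x) x) (jet U z x))"
    using \<beta> v w z H1_lincomb(1)[OF U v w, of a c] unfolding jet_bilinear_def by blast+
  have bil: "bilinear (\<beta> x)" for x using \<beta> unfolding jet_bilinear_def by blast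
  have "jet_form U \<beta> (\<lambda>x. a * v x + c * w x) z
      = (\<integral>x. a * \<beta> x (jet U v x) (jet U z x) + c * \<beta> x (jet U w x) (jet U z x) \<partial>lebesgue_on U)"
    unfolding jet_form_def
  proof (rule integral_cong_AE)
    show "AE x in lebesgue_on U. \<beta> x (jet U (\<lambda>x. a * v x + c * w x) x) (jet U z x)
        = a * \<beta> x (jet U v x) (jet U z x) + c * \<beta> x (jet U w x) (jet U z x)"
      using jet_lincomb[OF U v w, of a c]
      by eventually_elim (simp add: bilinear_ladd[OF bil] bilinear_lmul[OF bil])
  qed (use I in simp_all)
  also have "\<dots> = a * jet_form U \<beta> v z + c * jet_form U \<beta> w z"
    unfolding jet_form_def using I by simp
  finally show ?thesis .
qed

lemma jet_form_lincomb_right: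
  assumes U: "open U" and \<beta>: "jet_bilinear U \<beta>" and v: "H1 U v" and w: "H1 U w" and z: "H1 U z"
  shows "jet_form U \<beta> z (\<lambda>x. a * v x + c * w x) = a * jet_form U \<beta> z v + c * jet_form U \<beta> z w"
  using jet_form_lincomb_left[OF U jet_bilinear_flip[OF \<beta>] v w z] unfolding jet_form_def .

lemma jet_form_diff_left:
  assumes U: "open U" and \<beta>: "jet_bilinear U \<beta>" and v: "H1 U v" and w: "H1 U w" and z: "H1 U z"
  shows "jet_form U \<beta> (\<lambda>x. v x - w x) z = jet_form U \<beta> v z - jet_form U \<beta> w z"
  using jet_form_lincomb_left[OF assms, of 1 "-1"] by simp

lemma H1_diff: "open U \<Longrightarrow> H1 U v \<Longrightarrow> H1 U w \<Longrightarrow> H1 U (\<lambda>x. v x - w x)"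
  using H1_lincomb(1)[of U v w 1 "-1"] by simp

lemma H1_sum:
  assumes U: "open U" and z: "H1 U z" and A: "finite A" and f: "\<And>k. k \<in> A \<Longrightarrow> H1 U (f k)"
  shows "H1 U (\<lambda>x. \<Sum>k\<in>A. c k * f k x)"
  using A f
proof (induction A rule: finite_induct)
  case empty
  \<comment> \<open>The empty sum is the zero function, obtained as
    \<open>0 * z x + 0 * z x\<close>; \<open>z\<close> serves as a witness that \<open>H1\<close> is
    inhabited.\<close>
  then show ?case using H1_lincomb(1)[OF U z z, of 0 0] by simp
next
  case (insert k A)
  have "H1 U (\<lambda>x. c k * f k x + 1 * (\<Sum>k\<in>A. c k * f k x))"
    by (rule H1_lincomb(1)[OF U]) (use insert in auto)
  then show ?case using insert by simp
qed

lemma jet_form_sum_left: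
  assumes U: "open U" and \<beta>: "jet_bilinear U \<beta>" and z: "H1 U z"
    and A: "finite A" and f: "\<And>k. k \<in> A \<Longrightarrow> H1 U (f k)"
  shows "jet_form U \<beta> (\<lambda>x. \<Sum>k\<in>A. c k * f k x) z = (\<Sum>k\<in>A. c k * jet_form U \<beta> (f k) z)"
  using A f
proof (induction A rule: finite_induct)
  case empty
  then show ?case using jet_form_lincomb_left[OF U \<beta> z z z, of 0 0] by simp
next
  case (insert k A)
  have "jet_form U \<beta> (\<lambda>x. c k * f k x + 1 * (\<Sum>k\<in>A. c k * f k x)) z
      = c k * jet_form U \<beta> (f k) z + 1 * jet_form U \<beta> (\<lambda>x. \<Sum>k\<in>A. c k * f k x) z"
    by (rule jet_form_lincomb_left[OF U \<beta> _ H1_sum[OF U z] z]) (use insert in auto)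
  then show ?case using insert by simp
qed

lemma jet_form_sum_right:
  assumes U: "open U" and \<beta>: "jet_bilinear U \<beta>" and z: "H1 U z"
    and A: "finite A" and f: "\<And>k. k \<in> A \<Longrightarrow> H1 U (f k)"
  shows "jet_form U \<beta> z (\<lambda>x. \<Sum>k\<in>A. c k * f k x) = (\<Sum>k\<in>A. c k * jet_form U \<beta> z (f k))"
  using jet_form_sum_left[OF U jet_bilinear_flip[OF \<beta>] z A f, where c = c] unfolding jet_form_def by simp

text \<open>The minimum of the Rayleigh quotient on the unit sphere is an eigenvalue.\<close>

lemma symmetric_eigval_pos_imp_psd:
  fixes A :: "real ^ 'd::finite ^ 'd"
  assumes sym: "transpose A = A" and ev: "\<And>\<mu>. eigval A \<mu> \<Longrightarrow> 0 \<le> \<mu>"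
  shows "0 \<le> (A *v h) \<bullet> h"
proof -
  have sym': "(A *v x) \<bullet> y = (A *v y) \<bullet> x" for x y
    by (metis dot_lmul_matrix inner_commute sym transpose_matrix_vector)
  have cont: "continuous_on (sphere 0 1) (\<lambda>x. (A *v x) \<bullet> x)"
    by (intro continuous_intros linear_continuous_on matrix_vector_mul_bounded_linear)
  have "sphere (0::real^'d) 1 \<noteq> {}" by simp
  then obtain u where u: "u \<in> sphere 0 1" "\<And>y. y \<in> sphere 0 1 \<Longrightarrow> (A *v u) \<bullet> u \<le> (A *v y) \<bullet> y"
    using continuous_attains_inf[OF compact_sphere _ cont] by blast
  define m where "m = (A *v u) \<bullet> u"
  have u1: "u \<bullet> u = 1" using u(1) by (simp add: dot_square_norm)
  \<comment> \<open>The minimum over the sphere, extended to all vectors by homogeneity.\<close>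
  have rayleigh: "m * (y \<bullet> y) \<le> (A *v y) \<bullet> y" for y
  proof (cases "y = 0")
    case False
    define z where "z = y /\<^sub>R norm y"
    have "m \<le> (A *v z) \<bullet> z" using u(2)[of z] False by (simp add: z_def m_def)
    also have "(A *v z) \<bullet> z = ((A *v y) \<bullet> y) / (y \<bullet> y)"
      by (simp add: z_def matrix_vector_mult_scaleR dot_square_norm power2_eq_square field_simps)
    finally show ?thesis using False by (simp add: pos_le_divide_eq)
  qed simp
  \<comment> \<open>Optimality along \<open>u + t *\<^sub>R w\<close>, where \<open>w\<close> is the
    eigenvalue residual: the constant term vanishes at the minimizer, and the linear term is
    \<open>2 * t * (w \<bullet> w)\<close>.\<close>
  have "A *v u - m *\<^sub>R u = 0"
  proof -
    define w where "w = A *v u - m *\<^sub>R u"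
    have "0 \<le> (A *v w) \<bullet> w - m * (w \<bullet> w)" using rayleigh[of w] by simp
    moreover have "0 \<le> ((A *v w) \<bullet> w - m * (w \<bullet> w)) * t\<^sup>2 + 2 * t * (w \<bullet> w)" for t
    proof -
      have "0 \<le> (A *v (u + t *\<^sub>R w)) \<bullet> (u + t *\<^sub>R w) - m * ((u + t *\<^sub>R w) \<bullet> (u + t *\<^sub>R w))"
        using rayleigh[of "u + t *\<^sub>R w"] by simp
      also have "\<dots> = ((A *v u) \<bullet> u - m * (u \<bullet> u)) + 2 * t * ((A *v u) \<bullet> w - m * (u \<bullet> w))
          + t\<^sup>2 * ((A *v w) \<bullet> w - m * (w \<bullet> w))"
        by (simp add: matrix_vector_right_distrib matrix_vector_mult_scaleR inner_add_left inner_add_right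
            sym'[of w u] inner_commute[of w u] algebra_simps power2_eq_square)
      also have "(A *v u) \<bullet> u - m * (u \<bullet> u) = 0" using u1 by (simp add: m_def)
      also have "(A *v u) \<bullet> w - m * (u \<bullet> w) = w \<bullet> w"
        by (simp add: w_def inner_diff_left)
      finally show ?thesis by (simp add: mult.commute)
    qed
    \<comment> \<open>A quadratic without constant term that is nonnegative for all \<open>t\<close>
      has no linear term: the discriminant bound with \<open>a = 0\<close>.\<close>
    ultimately have "(w \<bullet> w)\<^sup>2 \<le> 0 * ((A *v w) \<bullet> w - m * (w \<bullet> w))"
      by (intro semi_inner_Cauchy_Schwarz) (simp_all add: algebra_simps)
    then show ?thesis by (simp add: w_def)
  qed
  then have "eigval A m" unfolding eigval_def using u1 by (intro exI[of _ u]) auto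
  then have "0 \<le> m" by (rule ev)
  then show ?thesis using rayleigh[of h] by (meson inner_ge_zero mult_nonneg_nonneg order_trans)
qed

section \<open>The forms of the model problem and the energy norm\<close>

definition a_int :: "'d::finite pde \<Rightarrow> real ^ 'd \<Rightarrow> (real ^ 'd) \<times> real \<Rightarrow> (real ^ 'd) \<times> real \<Rightarrow> real" where
  "a_int D x p q = (diffusion D x *v fst p) \<bullet> fst q"

definition b_int :: "'d::finite pde \<Rightarrow> real ^ 'd \<Rightarrow> (real ^ 'd) \<times> real \<Rightarrow> (real ^ 'd) \<times> real \<Rightarrow> real" where
  "b_int D x p q = a_int D x p q + (convection D x \<bullet> fst p) * snd q + reaction D x * snd p * snd q"

lemma model_problem_open: "model_problem D \<Longrightarrow> open (dom D)"
  unfolding model_problem_def polyhedral_lipschitz_domain_def lipschitz_domain_def by blast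

text \<open>In coordinates every integrand is a finite sum of products of one essentially bounded
  and two square integrable functions.\<close>

lemma integrable_form_integrands:
  assumes D: "model_problem D" and v: "H1 (dom D) v" and w: "H1 (dom D) w"
  shows "integrable (lebesgue_on (dom D)) (\<lambda>x. (diffusion D x *v wgrad (dom D) v x) \<bullet> wgrad (dom D) w x)"
    and "integrable (lebesgue_on (dom D)) (\<lambda>x. (convection D x \<bullet> wgrad (dom D) v x) * w x)"
    and "integrable (lebesgue_on (dom D)) (\<lambda>x. reaction D x * v x * w x)"
proof -
  have K: "Linf (dom D) (diffusion D)" and b: "Linf (dom D) (convection D)" and c: "Linf (dom D) (reaction D)"
    using D unfolding model_problem_def by blast+
  note gv = H1_wgrad(2)[OF model_problem_open[OF D] v] and gw = H1_wgrad(2)[OF model_problem_open[OF D] w]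
  have L: "L2 (dom D) v" "L2 (dom D) w" using v w unfolding H1_def by blast+
  have "(\<lambda>x. (diffusion D x *v wgrad (dom D) v x) \<bullet> wgrad (dom D) w x)
      = (\<lambda>x. \<Sum>i\<in>UNIV. \<Sum>j\<in>UNIV. diffusion D x $ i $ j * wgrad (dom D) v x $ j * wgrad (dom D) w x $ i)"
    by (simp add: inner_vec_def matrix_vector_mult_def sum_distrib_right)
  then show "integrable (lebesgue_on (dom D)) (\<lambda>x. (diffusion D x *v wgrad (dom D) v x) \<bullet> wgrad (dom D) w x)"
    by (simp only:) (intro Bochner_Integration.integrable_sum integrable_Linf_L2_L2 Linf_component K
        L2_component gv gw)
  have "(\<lambda>x. (convection D x \<bullet> wgrad (dom D) v x) * w x)
      = (\<lambda>x. \<Sum>i\<in>UNIV. convection D x $ i * wgrad (dom D) v x $ i * w x)"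
    by (simp add: inner_vec_def sum_distrib_right)
  then show "integrable (lebesgue_on (dom D)) (\<lambda>x. (convection D x \<bullet> wgrad (dom D) v x) * w x)"
    by (simp only:) (intro Bochner_Integration.integrable_sum integrable_Linf_L2_L2 Linf_component b
        L2_component gv L)
  show "integrable (lebesgue_on (dom D)) (\<lambda>x. reaction D x * v x * w x)"
    by (intro integrable_Linf_L2_L2 c L)
qed

lemma jet_bilinear_a_int:
  assumes D: "model_problem D"
  shows "jet_bilinear (dom D) (a_int D)"
  unfolding jet_bilinear_def
proof (intro conjI allI impI)
  show "bilinear (a_int D x)" for x
    unfolding a_int_def bilinear_def
    by (simp add: linear_iff matrix_vector_right_distrib matrix_vector_mult_scaleR
        inner_add_left inner_add_right)
qed (use integrable_form_integrands(1)[OF D] in \<open>simp add: a_int_def jet_def\<close>)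

lemma jet_bilinear_b_int:
  assumes D: "model_problem D"
  shows "jet_bilinear (dom D) (b_int D)"
  unfolding jet_bilinear_def
proof (intro conjI allI impI)
  show "bilinear (b_int D x)" for x
    unfolding b_int_def a_int_def bilinear_def
    by (simp add: linear_iff matrix_vector_right_distrib matrix_vector_mult_scaleR
        inner_add_left inner_add_right algebra_simps)
qed (use integrable_form_integrands[OF D] in \<open>simp add: b_int_def a_int_def jet_def\<close>)

lemma a_form_eq_jet_form: "a_form D = jet_form (dom D) (a_int D)"
  by (intro ext) (simp add: a_form_def jet_form_def a_int_def jet_def)

text \<open>\<open>b_form\<close> adds three integrals, \<open>jet_form\<close> integrates one sum.
  They agree by integrability, hence the two \<open>H1\<close> assumptions, which the single
  integral in \<open>a_form\<close> does not call for.\<close>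

lemma b_form_eq_jet_form:
  assumes "model_problem D" "H1 (dom D) v" "H1 (dom D) w"
  shows "b_form D v w = jet_form (dom D) (b_int D) v w"
  using integrable_form_integrands[OF assms]
  by (simp add: b_form_def a_form_def jet_form_def b_int_def a_int_def jet_def)

lemma a_form_commute:
  assumes D: "model_problem D" and v: "H1 (dom D) v" and w: "H1 (dom D) w"
  shows "a_form D v w = a_form D w v"
  unfolding a_form_def
proof (rule integral_cong_AE)
  have "AE x in lebesgue_on (dom D). transpose (diffusion D x) = diffusion D x"
    using D unfolding model_problem_def by blast
  then show "AE x in lebesgue_on (dom D). (diffusion D x *v wgrad (dom D) v x) \<bullet> wgrad (dom D) w x
      = (diffusion D x *v wgrad (dom D) w x) \<bullet> wgrad (dom D) v x"
    by eventually_elim (metis dot_lmul_matrix inner_commute transpose_matrix_vector)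
qed (use integrable_form_integrands(1)[OF D] v w in auto)

text \<open>The lower bound on the eigenvalues makes the integrand nonnegative almost everywhere.
  That fixes the sign of the Bochner integral for every \<open>v\<close>, so
  \<open>enorm_square\<close> holds without regularity of \<open>v\<close>.\<close>

lemma a_form_nonneg:
  assumes D: "model_problem D"
  shows "0 \<le> a_form D v v"
  unfolding a_form_def
proof (rule integral_nonneg_AE)
  obtain \<kappa> where "\<kappa> > 0"
    "AE x in lebesgue_on (dom D). \<forall>\<mu>. eigval (diffusion D x) \<mu> \<longrightarrow> \<kappa> \<le> \<mu>"
    "AE x in lebesgue_on (dom D). transpose (diffusion D x) = diffusion D x"
    using D unfolding model_problem_def by blast
  note this(2,3)
  then show "AE x in lebesgue_on (dom D). 0 \<le> (diffusion D x *v wgrad (dom D) v x) \<bullet> wgrad (dom D) v x"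
    by eventually_elim (use \<open>\<kappa> > 0\<close> in \<open>force intro!: symmetric_eigval_pos_imp_psd\<close>)
qed

lemma enorm_nonneg: "model_problem D \<Longrightarrow> 0 \<le> enorm D v"
  and enorm_square: "model_problem D \<Longrightarrow> (enorm D v)\<^sup>2 = a_form D v v"
  by (simp_all add: enorm_def a_form_nonneg)

lemma enorm_triangle:
  assumes D: "model_problem D" and v: "H1 (dom D) v" and w: "H1 (dom D) w"
  shows "enorm D (\<lambda>x. v x + w x) \<le> enorm D v + enorm D w"
proof -
  note U = model_problem_open[OF D]
  note l = jet_form_lincomb_left[OF U jet_bilinear_a_int[OF D], folded a_form_eq_jet_form]
  note r = jet_form_lincomb_right[OF U jet_bilinear_a_int[OF D], folded a_form_eq_jet_form]
  \<comment> \<open>One expansion used twice: nonnegativity for all \<open>t\<close> yields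
    Cauchy-Schwarz, and \<open>t = 1\<close> yields the square of the norm of the sum.\<close>
  have expand: "a_form D (\<lambda>x. 1 * v x + t * w x) (\<lambda>x. 1 * v x + t * w x)
      = a_form D v v + 2 * t * a_form D v w + t\<^sup>2 * a_form D w w" for t
    using a_form_commute[OF D w v] l[OF v w H1_lincomb(1)[OF U v w, of 1 t], of 1 t]
      r[OF v w v, of 1 t] r[OF v w w, of 1 t]
    by (simp add: algebra_simps power2_eq_square)
  have "(a_form D v w)\<^sup>2 \<le> a_form D v v * a_form D w w"
    using a_form_nonneg[OF D] by (intro semi_inner_Cauchy_Schwarz) (simp_all flip: expand)
  then have "\<bar>a_form D v w\<bar> \<le> enorm D v * enorm D w"
    unfolding enorm_def by (simp add: real_le_rsqrt flip: real_sqrt_mult)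
  then have "(enorm D (\<lambda>x. v x + w x))\<^sup>2 \<le> (enorm D v + enorm D w)\<^sup>2"
    using expand[of 1] by (simp add: enorm_square[OF D] power2_sum)
  then show ?thesis
    using enorm_nonneg[OF D] by (meson add_nonneg_nonneg power2_le_imp_le)
qed

section \<open>Quasi-error equivalence\<close>

lemma fe_space_H10: "v \<in> fe_space D p M \<Longrightarrow> v \<in> H10 (dom D)"
  and fe_space_H1: "v \<in> fe_space D p M \<Longrightarrow> H1 (dom D) v"
  unfolding fe_space_def H10_def by blast+

lemma comb_unit_vec: "j < N \<Longrightarrow> comb N \<phi> (unit_vec N j) = \<phi> j"
  by (rule ext) (simp add: comb_def unit_vec_def if_distrib[of "\<lambda>a. a * _"] cong: if_cong)

lemma comb_diff:
  assumes "y \<in> carrier_vec N" "x \<in> carrier_vec N"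
  shows "comb N \<phi> (y - x) = (\<lambda>t. comb N \<phi> y t - comb N \<phi> x t)"
proof (rule ext)
  fix t
  have "comb N \<phi> (y - x) t = (\<Sum>j<N. vec_index y j * \<phi> j t - vec_index x j * \<phi> j t)"
    unfolding comb_def by (rule sum.cong) (use assms in \<open>auto simp: algebra_simps\<close>)
  then show "comb N \<phi> (y - x) t = comb N \<phi> y t - comb N \<phi> x t"
    by (simp add: comb_def sum_subtractf)
qed

text \<open>\<open>is_basis\<close> constrains only the combinations; the basis functions themselves
  are reached through unit vectors.\<close>

lemma is_basis_mem:
  assumes "is_basis N \<phi> X"
  shows "x \<in> carrier_vec N \<Longrightarrow> comb N \<phi> x \<in> X" and "j < N \<Longrightarrow> \<phi> j \<in> X"
proof -
  show c: "comb N \<phi> x \<in> X" if "x \<in> carrier_vec N" for x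
    using assms that unfolding is_basis_def by (rule bij_betwE[THEN bspec])
  show "\<phi> j \<in> X" if "j < N"
    using c[OF unit_vec_carrier[of N j]] comb_unit_vec[OF that, of \<phi>] by simp
qed

text \<open>The Galerkin equations turn the load entries into values of \<open>b_form\<close> at
  \<open>u\<close>. Rows of the stiffness matrix belong to test functions and columns to trial
  functions, so \<open>x\<close> is summed in the first argument and \<open>z\<close> in the
  second.\<close>

lemma residual_scalar_prod:
  assumes D: "model_problem D" and \<phi>: "\<And>j. j < N \<Longrightarrow> H1 (dom D) (\<phi> j)" and u: "H1 (dom D) u"
    and galerkin: "\<And>j. j < N \<Longrightarrow> b_form D u (\<phi> j) = F_form D (\<phi> j)"
    and x: "x \<in> carrier_vec N" and z: "z \<in> carrier_vec N"
  shows "scalar_prod (load_vec D N \<phi> - stiffness D N \<phi> *\<^sub>v x) z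
    = b_form D (\<lambda>t. u t - comb N \<phi> x t) (comb N \<phi> z)"
proof -
  note U = model_problem_open[OF D]
  have H: "H1 (dom D) (comb N \<phi> y)" for y
    unfolding comb_def by (rule H1_sum[OF U u]) (use \<phi> in auto)
  note e = H1_diff[OF U u H[of x]]
  have idx: "vec_index (load_vec D N \<phi> - stiffness D N \<phi> *\<^sub>v x) j
      = b_form D (\<lambda>t. u t - comb N \<phi> x t) (\<phi> j)" if j: "j < N" for j
  proof -
    have "vec_index (load_vec D N \<phi> - stiffness D N \<phi> *\<^sub>v x) j
        = b_form D u (\<phi> j) - (\<Sum>k<N. vec_index x k * b_form D (\<phi> k) (\<phi> j))"
      using j x galerkin[OF j]
      by (simp add: load_vec_def stiffness_def scalar_prod_def atLeast0LessThan mult.commute)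
    also have "(\<Sum>k<N. vec_index x k * b_form D (\<phi> k) (\<phi> j))
        = (\<Sum>k<N. vec_index x k * jet_form (dom D) (b_int D) (\<phi> k) (\<phi> j))"
      by (rule sum.cong) (use b_form_eq_jet_form[OF D] \<phi> j in auto)
    also have "\<dots> = jet_form (dom D) (b_int D) (comb N \<phi> x) (\<phi> j)"
      unfolding comb_def
      by (rule jet_form_sum_left[OF U jet_bilinear_b_int[OF D], symmetric]) (use \<phi> j in auto)
    also have "b_form D u (\<phi> j) - \<dots> = b_form D (\<lambda>t. u t - comb N \<phi> x t) (\<phi> j)"
      using jet_form_diff_left[OF U jet_bilinear_b_int[OF D] u H[of x] \<phi>[OF j]]
      by (simp add: b_form_eq_jet_form[OF D] u e \<phi>[OF j])
    finally show ?thesis .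
  qed
  have "scalar_prod (load_vec D N \<phi> - stiffness D N \<phi> *\<^sub>v x) z
      = (\<Sum>j<N. vec_index z j * vec_index (load_vec D N \<phi> - stiffness D N \<phi> *\<^sub>v x) j)"
    using z by (simp add: scalar_prod_def atLeast0LessThan mult.commute)
  also have "\<dots> = (\<Sum>j<N. vec_index z j * jet_form (dom D) (b_int D) (\<lambda>t. u t - comb N \<phi> x t) (\<phi> j))"
    by (rule sum.cong) (use idx b_form_eq_jet_form[OF D e] \<phi> in auto)
  also have "\<dots> = jet_form (dom D) (b_int D) (\<lambda>t. u t - comb N \<phi> x t) (comb N \<phi> z)"
    unfolding comb_def[of N \<phi> z]
    by (rule jet_form_sum_right[OF U jet_bilinear_b_int[OF D] e, symmetric]) (use \<phi> in auto)
  finally show ?thesis using b_form_eq_jet_form[OF D e H] by simp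
qed

lemma enorm_error_equiv_residual:
  assumes D: "model_problem D" and ell: "bounded_elliptic D Cell Cbnd"
    and u: "galerkin_solution D p M u" and basis: "is_basis N \<phi> (fe_space D p M)"
    and P: "spd N P" and x: "x \<in> carrier_vec N" and Cpre: "1 \<le> Cpre"
    and pre: "\<And>y. y \<in> carrier_vec N \<Longrightarrow> inverse Cpre * enorm D (comb N \<phi> y) \<le> pnorm P y"
      "\<And>y. y \<in> carrier_vec N \<Longrightarrow> pnorm P y \<le> Cpre * enorm D (comb N \<phi> y)"
  defines "s \<equiv> presid P (stiffness D N \<phi>) (load_vec D N \<phi>) x"
  shows "enorm D (\<lambda>t. u t - comb N \<phi> x t) \<le> inverse Cell * Cpre * pnorm P s"
    and "pnorm P s \<le> Cbnd * Cpre * enorm D (\<lambda>t. u t - comb N \<phi> x t)"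
proof -
  let ?e = "\<lambda>t. u t - comb N \<phi> x t" and ?r = "load_vec D N \<phi> - stiffness D N \<phi> *\<^sub>v x"
  obtain Q where Q: "mat_inverse P = Some Q" using spd_mat_inverse_exists[OF P] .
  have Pc: "P \<in> carrier_mat N N" using P unfolding spd_def by blast
  have uX: "u \<in> fe_space D p M" using u unfolding galerkin_solution_def by blast
  have B: "stiffness D N \<phi> \<in> carrier_mat N N" and d: "load_vec D N \<phi> \<in> carrier_vec N"
    by (simp_all add: stiffness_def load_vec_def)
  have r: "?r \<in> carrier_vec N" using mult_mat_vec_carrier[OF B x] d by simp
  then have s: "s \<in> carrier_vec N" using Pc unfolding s_def presid_def by simp
  \<comment> \<open>The inverse preconditioner recovers the plain algebraic residual.\<close>
  have Qs: "Q *\<^sub>v s = ?r" unfolding s_def presid_def using spd_mat_inverse(3)[OF P Q r] .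
  have res: "scalar_prod (Q *\<^sub>v s) z = b_form D ?e (comb N \<phi> z)" if "z \<in> carrier_vec N" for z
    unfolding Qs
  proof (rule residual_scalar_prod[OF D _ fe_space_H1[OF uX] _ x that])
    show "H1 (dom D) (\<phi> j)" if "j < N" for j
      using fe_space_H1[OF is_basis_mem(2)[OF basis that]] .
    show "b_form D u (\<phi> j) = F_form D (\<phi> j)" if "j < N" for j
      using is_basis_mem(2)[OF basis that] u unfolding galerkin_solution_def by simp
  qed
  \<comment> \<open>Surjectivity of the coefficient map gives the Galerkin solution coefficients
    \<open>xu\<close>. Thus the error is itself discrete, with coefficients \<open>xu - x\<close>,
    and may be used as a test function.\<close>
  have "u \<in> comb N \<phi> ` carrier_vec N"
    using basis uX unfolding is_basis_def bij_betw_def by blast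
  then obtain xu where xu: "xu \<in> carrier_vec N" "u = comb N \<phi> xu" by blast
  have y: "xu - x \<in> carrier_vec N" using xu(1) x by simp
  have ey: "comb N \<phi> (xu - x) = ?e" using comb_diff[OF xu(1) x, of \<phi>] xu(2) by simp
  have eH: "?e \<in> H10 (dom D)" using fe_space_H10[OF is_basis_mem(1)[OF basis y]] ey by simp
  have sH: "comb N \<phi> s \<in> H10 (dom D)" using fe_space_H10[OF is_basis_mem(1)[OF basis s]] .
  have Cell: "0 < Cell" and Cbnd: "0 < Cbnd" using ell unfolding bounded_elliptic_def by auto
  note e0 = enorm_nonneg[OF D, of ?e] and s0 = pnorm_square(2)[OF P Q s]
  have "Cell * (enorm D ?e)\<^sup>2 \<le> b_form D ?e ?e"
    using ell eH unfolding bounded_elliptic_def by blast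
  also have "\<dots> = scalar_prod (Q *\<^sub>v s) (xu - x)" using res[OF y] ey by simp
  also have "\<dots> \<le> pnorm P s * pnorm P (xu - x)" by (rule pnorm_Cauchy_Schwarz[OF P Q s y])
  also have "\<dots> \<le> pnorm P s * (Cpre * enorm D ?e)"
    using pre(2)[OF y] s0 ey by (intro mult_left_mono) auto
  finally have lower: "(Cell * enorm D ?e) * enorm D ?e \<le> (Cpre * pnorm P s) * enorm D ?e"
    by (simp add: power2_eq_square mult_ac)
  \<comment> \<open>Cancelling a common factor requires it to be positive; if it is 0, the claim
    reduces to nonnegativity of the right-hand side. The upper bound below is finished in the same
    way.\<close>
  have "Cell * enorm D ?e \<le> Cpre * pnorm P s"
  proof (cases "enorm D ?e = 0")
    case True
    then show ?thesis using Cpre s0 by simp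
  next
    case False
    then show ?thesis using lower e0 by (simp add: mult_le_cancel_right)
  qed
  then show "enorm D ?e \<le> inverse Cell * Cpre * pnorm P s"
    using Cell by (simp add: field_simps)
  have "pnorm P s * pnorm P s = b_form D ?e (comb N \<phi> s)"
    using pnorm_square(1)[OF P Q s] res[OF s] by (simp add: power2_eq_square)
  also have "\<dots> \<le> \<bar>b_form D ?e (comb N \<phi> s)\<bar>" by simp
  also have "\<dots> \<le> Cbnd * enorm D ?e * enorm D (comb N \<phi> s)"
    using ell eH sH unfolding bounded_elliptic_def by blast
  also have "\<dots> \<le> Cbnd * enorm D ?e * (Cpre * pnorm P s)"
    using pre(1)[OF s] Cpre Cbnd e0 by (intro mult_left_mono) (auto simp: field_simps)
  finally have upper: "pnorm P s * pnorm P s \<le> (Cbnd * Cpre * enorm D ?e) * pnorm P s"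
    by (simp add: mult_ac)
  show "pnorm P s \<le> Cbnd * Cpre * enorm D ?e"
  proof (cases "pnorm P s = 0")
    case True
    then show ?thesis using Cpre Cbnd e0 by simp
  next
    case False
    then show ?thesis using upper s0 by (simp add: mult_le_cancel_right)
  qed
qed

section \<open>Estimator, meshes and iterates of a run\<close>

lemma eta_on_nonneg: "0 \<le> eta_on D M U v"
  unfolding eta_on_def eta_elem_sq_def jump_sq_def Let_def
  by (intro real_sqrt_ge_zero sum_nonneg add_nonneg_nonneg mult_nonneg_nonneg integral_nonneg_AE)
     auto

lemma refinements_refl: "conforming M \<Longrightarrow> M \<in> refinements M"
  unfolding refinements_def by simp

lemma refinements_trans: "M' \<in> refinements M \<Longrightarrow> M'' \<in> refinements M' \<Longrightarrow> M'' \<in> refinements M"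
  unfolding refinements_def by (auto intro: rtrancl_trans)

lemma axiom_stability_same_mesh:
  assumes "axiom_stability D p T0 Cstab" and M: "M \<in> refinements T0"
    and "v \<in> fe_space D p M" "w \<in> fe_space D p M"
  shows "\<bar>eta D M v - eta D M w\<bar> \<le> Cstab * enorm D (\<lambda>x. v x - w x)"
proof -
  \<comment> \<open>Taking both meshes equal turns the common elements into all of \<open>M\<close>.
    The conformity required for this is part of membership in \<open>refinements T0\<close>.\<close>
  have "M \<in> refinements M" using M refinements_refl unfolding refinements_def by blast
  with assms have "\<bar>eta_on D M (M \<inter> M) v - eta_on D M (M \<inter> M) w\<bar> \<le> Cstab * enorm D (\<lambda>x. v x - w x)"
    unfolding axiom_stability_def by blast
  then show ?thesis by simp
qed

lemma afem_mesh_refinements: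
  assumes T0: "conforming T0" and alg: "afem_pgmres D p T0 \<theta> Cmark Calg lamalg kmax \<tau> R"
    and "reached D \<tau> R l"
  shows "mesh R l \<in> refinements T0"
  using assms(3)
proof induction
  case 1
  have "mesh R 0 = T0" using alg unfolding afem_pgmres_def by blast
  then show ?case using refinements_refl[OF T0] by simp
next
  case (2 l k)
  then have "next_level D \<theta> Cmark R l k" using alg unfolding afem_pgmres_def by blast
  then have "mesh R (Suc l) \<in> refinements (mesh R l)"
    unfolding next_level_def is_refine_def by blast
  with 2 show ?case using refinements_trans by blast
qed

lemma solve_level_coeffs_carrier:
  assumes "solve_level D p kmax R l" and "enat k \<le> kbar R l"
  shows "coeffs R l k \<in> carrier_vec (ndof R l)"
proof (cases "k = 0")
  case True
  then show ?thesis using assms(1) unfolding solve_level_def by blast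
next
  case False
  then have "1 \<le> k" by simp
  with assms have "pgmres_step kmax (ndof R l) (precond R l) (stiffness D (ndof R l) (basis R l))
      (load_vec D (ndof R l) (basis R l)) (coeffs R l) k" and "precond R l \<in> carrier_mat (ndof R l) (ndof R l)"
    unfolding solve_level_def spd_def by blast+
  then show ?thesis by (intro pgmres_step_carrier) (auto simp: stiffness_def)
qed

theorem lemma16:
  fixes D :: "'d::finite pde" and T0 :: "'d mesh" and R :: "'d run"
    and ustar :: "real ^ 'd \<Rightarrow> real" and uG :: "'d mesh \<Rightarrow> real ^ 'd \<Rightarrow> real"
    and p kmax :: nat
    and Cell Cbnd Cstab qred Crel Cdrel Cpre \<theta> Cmark Calg lamalg \<tau> Ceq Crel' :: real
  assumes "model_problem D"
    and "bounded_elliptic D Cell Cbnd"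
    and "exact_solution D ustar"
    and "initial_mesh D T0"
    and "1 \<le> p"
    and "\<forall>M\<in>refinements T0. galerkin_solution D p M (uG M)"
    and "0 < Cstab" and "axiom_stability D p T0 Cstab"
    and "0 < qred" and "qred < 1" and "axiom_reduction D p T0 qred"
    and "0 < Crel" and "axiom_reliability D T0 ustar uG Crel"
    and "0 < Cdrel" and "axiom_discrete_reliability D T0 uG Cdrel"
    and "afem_pgmres D p T0 \<theta> Cmark Calg lamalg kmax \<tau> R"
    and "norm_equivalence D \<tau> R Cpre"
    and "Ceq = Max {1, (1 + Cstab) * inverse Cell * Cpre, Cbnd * Cpre + Cstab}"
    and "Crel' = Ceq * max Crel 1"
  shows "0 < Ceq \<and>
    (\<forall>(l, k) \<in> index_set D \<tau> R.
       inverse Ceq * (eta D (mesh R l) (uG (mesh R l))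
           + enorm D (\<lambda>x. uG (mesh R l) x - iterate R l k x)) \<le> quasi_error D R l k \<and>
       quasi_error D R l k \<le> Ceq * (eta D (mesh R l) (uG (mesh R l))
           + enorm D (\<lambda>x. uG (mesh R l) x - iterate R l k x))) \<and>
    0 < Crel' \<and>
    (\<forall>(l, k) \<in> index_set D \<tau> R.
       enorm D (\<lambda>x. ustar x - iterate R l k x) \<le> Crel' * quasi_error D R l k)"
proof -
  note D = assms(1) and ell = assms(2) and ustar = assms(3) and gal = assms(6) and stab = assms(8)
    and rel = assms(13) and alg = assms(16) and norm_eq = assms(17)
  have Ceq: "1 \<le> Ceq" "(1 + Cstab) * inverse Cell * Cpre \<le> Ceq" "Cbnd * Cpre + Cstab \<le> Ceq"
    unfolding assms(18) by (rule Max_ge; simp)+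
  have Crel': "0 < Crel'" using Ceq(1) assms(12) unfolding assms(19) by (simp add: max_def)
  have T0: "conforming T0" using assms(4) unfolding initial_mesh_def admissible_mesh_def by blast
  have main: "inverse Ceq * (eta D (mesh R l) (uG (mesh R l))
           + enorm D (\<lambda>x. uG (mesh R l) x - iterate R l k x)) \<le> quasi_error D R l k \<and>
       quasi_error D R l k \<le> Ceq * (eta D (mesh R l) (uG (mesh R l))
           + enorm D (\<lambda>x. uG (mesh R l) x - iterate R l k x)) \<and>
       enorm D (\<lambda>x. ustar x - iterate R l k x) \<le> Crel' * quasi_error D R l k"
    if lk: "(l, k) \<in> index_set D \<tau> R" for l k
  proof -
    let ?M = "mesh R l" and ?u = "uG (mesh R l)" and ?v = "iterate R l k"
    let ?e = "enorm D (\<lambda>x. ?u x - ?v x)" and ?s = "resid_norm D R l k"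
    have reach: "reached D \<tau> R l" and k: "enat k \<le> kbar R l" using lk unfolding index_set_def by auto
    have M: "?M \<in> refinements T0" by (rule afem_mesh_refinements[OF T0 alg reach])
    have solve: "solve_level D p kmax R l" using alg reach unfolding afem_pgmres_def by blast
    note x = solve_level_coeffs_carrier[OF solve k]
    have basis: "is_basis (ndof R l) (basis R l) (fe_space D p ?M)" and P: "spd (ndof R l) (precond R l)"
      using solve unfolding solve_level_def by blast+
    have u: "galerkin_solution D p ?M ?u" using gal M by blast
    then have uX: "?u \<in> fe_space D p ?M" unfolding galerkin_solution_def by blast
    have vX: "?v \<in> fe_space D p ?M" unfolding iterate_def by (rule is_basis_mem(1)[OF basis x])
    have Cpre: "1 \<le> Cpre" using norm_eq unfolding norm_equivalence_def by blast
    have pre: "inverse Cpre * enorm D (comb (ndof R l) (basis R l) y) \<le> pnorm (precond R l) y"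
      "pnorm (precond R l) y \<le> Cpre * enorm D (comb (ndof R l) (basis R l) y)"
      if "y \<in> carrier_vec (ndof R l)" for y
      using norm_eq reach that unfolding norm_equivalence_def by blast+
    note equiv = enorm_error_equiv_residual[OF D ell u basis P x Cpre pre,
        folded iterate_def resid_norm_def]
    have st: "\<bar>eta D ?M ?u - eta D ?M ?v\<bar> \<le> Cstab * ?e"
      by (rule axiom_stability_same_mesh[OF stab M uX vX])
    have eta0: "0 \<le> eta D ?M ?u" "0 \<le> eta D ?M ?v" by (rule eta_on_nonneg)+
    have e0: "0 \<le> ?e" by (rule enorm_nonneg[OF D])
    \<comment> \<open>The sign is read off from the error bound: a positive multiple of
      \<open>?s\<close> dominates the nonnegative \<open>?e\<close>.\<close>
    have s0: "0 \<le> ?s"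
      using equiv(1) e0 ell Cpre unfolding bounded_elliptic_def
      by (smt (verit) inverse_positive_iff_positive mult_pos_pos zero_le_mult_iff)
    \<comment> \<open>Stability replaces the Galerkin solution by the iterate, and the whole of
      \<open>(1 + Cstab) * ?e\<close> is then charged to the residual; this is the second entry of
      \<open>Ceq\<close>.\<close>
    have "eta D ?M ?u + ?e \<le> eta D ?M ?v + (1 + Cstab) * ?e"
      using st by (simp add: algebra_simps)
    also have "(1 + Cstab) * ?e \<le> (1 + Cstab) * (inverse Cell * Cpre * ?s)"
      using equiv(1) assms(7) by (intro mult_left_mono) auto
    also have "\<dots> \<le> Ceq * ?s"
      using mult_right_mono[OF Ceq(2) s0] by (simp add: mult_ac)
    also have "eta D ?M ?v \<le> Ceq * eta D ?M ?v" using mult_right_mono[OF Ceq(1) eta0(2)] by simp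
    finally have lower: "eta D ?M ?u + ?e \<le> Ceq * quasi_error D R l k"
      unfolding quasi_error_def by (simp add: distrib_left)
    \<comment> \<open>Here the residual contributes \<open>Cbnd * Cpre\<close> and stability
      contributes \<open>Cstab\<close>, both as multiples of \<open>?e\<close>; this is the third
      entry of \<open>Ceq\<close>.\<close>
    have "quasi_error D R l k \<le> eta D ?M ?u + (Cbnd * Cpre + Cstab) * ?e"
      using st equiv(2) unfolding quasi_error_def by (simp add: algebra_simps)
    also have "\<dots> \<le> Ceq * eta D ?M ?u + Ceq * ?e"
      using mult_right_mono[OF Ceq(1) eta0(1)] mult_right_mono[OF Ceq(3) e0] by simp
    finally have upper: "quasi_error D R l k \<le> Ceq * (eta D ?M ?u + ?e)" by (simp add: distrib_left)
    note U = model_problem_open[OF D]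
    have H: "H1 (dom D) ustar" "H1 (dom D) ?u" "H1 (dom D) ?v"
      using ustar fe_space_H1[OF uX] fe_space_H1[OF vX] unfolding exact_solution_def H10_def by blast+
    have "enorm D (\<lambda>x. ustar x - ?v x) \<le> enorm D (\<lambda>x. ustar x - ?u x) + ?e"
      using enorm_triangle[OF D H1_diff[OF U H(1,2)] H1_diff[OF U H(2,3)]] by simp
    also have "\<dots> \<le> Crel * eta D ?M ?u + ?e"
      using rel M unfolding axiom_reliability_def by simp
    \<comment> \<open>The factor \<open>max Crel 1\<close> covers both summands, so that the lower
      equivalence just proved applies to their sum.\<close>
    also have "\<dots> \<le> max Crel 1 * (eta D ?M ?u + ?e)"
      using mult_right_mono[OF max.cobounded1[of Crel 1] eta0(1)]
        mult_right_mono[OF max.cobounded2[of 1 Crel] e0] by (simp add: distrib_left)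
    also have "\<dots> \<le> max Crel 1 * (Ceq * quasi_error D R l k)"
      using lower by (intro mult_left_mono) auto
    finally have "enorm D (\<lambda>x. ustar x - ?v x) \<le> Crel' * quasi_error D R l k"
      unfolding assms(19) by (simp add: mult_ac)
    moreover have "inverse Ceq * (eta D ?M ?u + ?e) \<le> quasi_error D R l k"
      using lower Ceq(1) by (simp add: field_simps)
    ultimately show ?thesis using upper by blast
  qed
  have "0 < Ceq" using Ceq(1) by simp
  then show ?thesis using main Crel' by blast
qed

end
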